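(* Let $T,I$ be finite index sets, let $\mathbf{L}_t=(L_t,\leq)$ be an irreducible finite lattice for every $t\in T$, let $\mathbf{L}:=\prod_{t\in T}\mathbf{L}_t$, and let $A=(a_{i,j})\in \mathrm{Mat}_{I\times I}(\mathrm{Res}(\mathbf{L}))$. Put $\mathbf{L}_{t,i}:=\mathbf{L}_t$ for every $(t,i)\in T\times I$, so that $\mathbf{L}^I=\prod_{(t,i)\in T\times I}\mathbf{L}_{t,i}$. Then $A$ is invertible if and only if there exist a permutation $\sigma$ of $T\times I$ and a lattice isomorphism $\varphi_{t,i}:L_{t,i}\rightarrow L_{\sigma^{-1}(t,i)}$ for every $(t,i)\in T\times I$ such that for every $(t,i)\in T\times I$ $$\pi_t\circ A_i= \varphi_{\sigma(t,i)}\circ \pi_{\sigma(t,i)},$$ where $\pi_t$ is the projection from $\mathbf{L}$ to $\mathbf{L}_t$, $\pi_{t,i}$ is the projection from $\mathbf{L}^I$ to $\mathbf{L}_{t,i}$, and $A_i:L^I\to L$ is the $i$-th row of $A$ regarded as the mapping $A_i((x_j)_{j\in I})=\bigvee_{j\in I}a_{i,j}(x_j)$.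
   Context: A lattice is called irreducible if it has more than one element and is not isomorphic to a direct product of two lattices each having more than one element. For a finite lattice $\mathbf{L}=(L,\leq)$ with least element $0_{\mathbf{L}}$, $\mathrm{Res}(\mathbf{L})$ is the set of residuated mappings $f:L\to L$, i.e. those with $f(x\vee y)=f(x)\vee f(y)$ for all $x,y\in L$ and $f(0_{\mathbf{L}})=0_{\mathbf{L}}$. $(\mathrm{Res}(\mathbf{L}),\vee,\circ)$, with pointwise supremum as addition and composition as multiplication, is a semiring with zero the constant mapping $x\mapsto 0_{\mathbf{L}}$ and one $\mathrm{id}_L$. For a finite index set $I$, $\mathrm{Mat}_{I\times I}(\mathrm{Res}(\mathbf{L}))$ is the semiring of $I\times I$ matrices over this semiring, with entrywise addition and the product $(f_{i,j})\cdot(g_{i,j})=(h_{i,j})$, $h_{i,j}=\bigvee_{k\in I}f_{i,k}\circ g_{k,j}$. A matrix is invertible if it has a two-sided inverse with respect to this product (the identity matrix has $\mathrm{id}_L$ on the diagonal and the zero mapping elsewhere). *)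

theory Defs
  imports "HOL-Algebra.Ring" "HOL-Combinatorics.Permutations"
begin

definition lattice_iso :: "'a gorder \<Rightarrow> 'b gorder \<Rightarrow> ('a \<Rightarrow> 'b) set" where
  "lattice_iso M N =
     {f. bij_betw f (carrier M) (carrier N) \<and> join_pres M N f \<and> meet_pres M N f}"

definition binary_product :: "'a gorder \<Rightarrow> 'b gorder \<Rightarrow> ('a \<times> 'b) gorder" where
  "binary_product M N =
     \<lparr>carrier = carrier M \<times> carrier N,
      eq = (=),
      le = (\<lambda>x y. fst x \<sqsubseteq>\<^bsub>M\<^esub> fst y \<and> snd x \<sqsubseteq>\<^bsub>N\<^esub> snd y)\<rparr>"

definition product_lattice :: "'k set \<Rightarrow> ('k \<Rightarrow> 'a gorder) \<Rightarrow> ('k \<Rightarrow> 'a) gorder" where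
  "product_lattice K L =
     \<lparr>carrier = (\<Pi>\<^sub>E k\<in>K. carrier (L k)),
      eq = (=),
      le = (\<lambda>x y. \<forall>k\<in>K. x k \<sqsubseteq>\<^bsub>L k\<^esub> y k)\<rparr>"

text \<open>
  In the next definition both factors have elements of the same type as \<open>L\<close>. This
  loses no generality: a direct factor of \<open>L\<close> embeds into \<open>L\<close> (fix the other
  coordinate), so it is isomorphic to a lattice whose carrier is a subset of that of \<open>L\<close>.
\<close>

definition irreducible_lattice :: "'a gorder \<Rightarrow> bool" where
  "irreducible_lattice L \<longleftrightarrow>
     (\<exists>x\<in>carrier L. \<exists>y\<in>carrier L. x \<noteq> y) \<and>
     \<not> (\<exists>(M :: 'a gorder) (N :: 'a gorder).
          lattice M \<and> (\<exists>x\<in>carrier M. \<exists>y\<in>carrier M. x \<noteq> y) \<and>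
          lattice N \<and> (\<exists>x\<in>carrier N. \<exists>y\<in>carrier N. x \<noteq> y) \<and>
          lattice_iso L (binary_product M N) \<noteq> {})"

text \<open>
  Mappings on a carrier are represented by extensional functions, so that equality of
  ring elements is equality of mappings on the carrier.
\<close>

definition Res :: "'a gorder \<Rightarrow> ('a \<Rightarrow> 'a) ring" where
  "Res L =
     \<lparr>carrier = {f \<in> carrier L \<rightarrow>\<^sub>E carrier L. join_pres L L f \<and> f \<bottom>\<^bsub>L\<^esub> = \<bottom>\<^bsub>L\<^esub>},
      monoid.mult = compose (carrier L),
      one = (\<lambda>x\<in>carrier L. x),
      zero = (\<lambda>x\<in>carrier L. \<bottom>\<^bsub>L\<^esub>),
      add = (\<lambda>f g. \<lambda>x\<in>carrier L. f x \<squnion>\<^bsub>L\<^esub> g x)\<rparr>"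

definition Mat :: "'i set \<Rightarrow> 'r ring \<Rightarrow> ('i \<Rightarrow> 'i \<Rightarrow> 'r) ring" where
  "Mat I R =
     \<lparr>carrier = I \<rightarrow>\<^sub>E I \<rightarrow>\<^sub>E carrier R,
      monoid.mult = (\<lambda>F G. \<lambda>i\<in>I. \<lambda>j\<in>I. \<Oplus>\<^bsub>R\<^esub>k\<in>I. F i k \<otimes>\<^bsub>R\<^esub> G k j),
      one = (\<lambda>i\<in>I. \<lambda>j\<in>I. if i = j then \<one>\<^bsub>R\<^esub> else \<zero>\<^bsub>R\<^esub>),
      zero = (\<lambda>i\<in>I. \<lambda>j\<in>I. \<zero>\<^bsub>R\<^esub>),
      add = (\<lambda>F G. \<lambda>i\<in>I. \<lambda>j\<in>I. F i j \<oplus>\<^bsub>R\<^esub> G i j)\<rparr>"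

definition matrix_row ::
  "'i set \<Rightarrow> 'a gorder \<Rightarrow> ('i \<Rightarrow> 'i \<Rightarrow> 'a \<Rightarrow> 'a) \<Rightarrow> 'i \<Rightarrow> ('i \<Rightarrow> 'a) \<Rightarrow> 'a" where
  "matrix_row I L A i x = \<Squnion>\<^bsub>L\<^esub> ((\<lambda>j. A i j (x j)) ` I)"

definition proj :: "'t \<Rightarrow> ('t \<Rightarrow> 'a) \<Rightarrow> 'a" where
  "proj t x = x t"

text \<open>
  The projections of \<open>L\<^sup>I\<close>, where \<open>L\<close> is the product of the \<open>L t\<close>, under the
  identification of \<open>L\<^sup>I\<close> with the product over \<open>T \<times> I\<close>: an element of \<open>L\<^sup>I\<close> is kept
  in curried form \<open>i \<mapsto> t \<mapsto> x i t\<close>.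
\<close>

definition proj2 :: "'t \<times> 'i \<Rightarrow> ('i \<Rightarrow> 't \<Rightarrow> 'a) \<Rightarrow> 'a" where
  "proj2 = (\<lambda>(t, i) x. x i t)"

end

theory Submission
  imports Defs
begin

text \<open>
  Square matrices over \<open>Res L\<close> are the residuated mappings of \<open>L\<^sup>I\<close> in coordinates: a matrix \<open>A\<close>
  acts by its rows, and its entries are recovered from the images of the elements supported at a
  single index. Hence the invertible matrices are the lattice automorphisms of \<open>L\<^sup>I\<close>.

  An automorphism of a product of bounded irreducible lattices permutes the factors. Let \<open>e\<^sub>k\<close> be
  the element with \<open>\<top>\<close> at \<open>k\<close> and \<open>\<bottom>\<close> elsewhere, and \<open>e\<^sub>k'\<close> its complement; they split
  the product as a direct product of the ideals below them. Each component of an isomorphic image of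
  \<open>(e\<^sub>k, e\<^sub>k')\<close> splits the corresponding factor in the same way, so by irreducibility it is
  \<open>(\<top>, \<bottom>)\<close> or \<open>(\<bottom>, \<top>)\<close>. Applied to the isomorphism and to its inverse, this shows
  that the elements \<open>e\<^sub>k\<close> are permuted.
\<close>

section \<open>Lattices, isomorphisms and products\<close>

lemma (in upper_semilattice) join_le_iff:
  assumes "x \<in> carrier L" "y \<in> carrier L" "z \<in> carrier L"
  shows "x \<squnion> y \<sqsubseteq> z \<longleftrightarrow> x \<sqsubseteq> z \<and> y \<sqsubseteq> z"
  using assms by (meson join_closed join_le join_left join_right le_trans)

lemma (in lower_semilattice) le_meet_iff:
  assumes "x \<in> carrier L" "y \<in> carrier L" "z \<in> carrier L"
  shows "z \<sqsubseteq> x \<sqinter> y \<longleftrightarrow> z \<sqsubseteq> x \<and> z \<sqsubseteq> y"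
  using assms by (meson meet_closed meet_le meet_left meet_right le_trans)

lemma (in partial_order) eq_if_same_upper_bounds:
  assumes "x \<in> carrier L" "y \<in> carrier L"
    and "\<And>z. z \<in> carrier L \<Longrightarrow> x \<sqsubseteq> z \<longleftrightarrow> y \<sqsubseteq> z"
  shows "x = y"
  using assms by (meson le_antisym le_refl)

lemma (in partial_order) eq_if_same_lower_bounds:
  assumes "x \<in> carrier L" "y \<in> carrier L"
    and "\<And>z. z \<in> carrier L \<Longrightarrow> z \<sqsubseteq> x \<longleftrightarrow> z \<sqsubseteq> y"
  shows "x = y"
  using assms by (meson le_antisym le_refl)

lemma (in bounded_lattice) le_bottom_iff:
  "x \<in> carrier L \<Longrightarrow> x \<sqsubseteq> \<bottom> \<longleftrightarrow> x = \<bottom>"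
  using le_antisym bottom_lower bottom_closed le_refl by blast

lemma (in bounded_lattice) bound_simps [simp]:
  assumes "x \<in> carrier L"
  shows "x \<sqinter> \<top> = x" "x \<sqinter> \<bottom> = \<bottom>" "x \<squnion> \<bottom> = x" "\<bottom> \<squnion> x = x"
  using assms bottom_meet[of x] top_meet[of x] bottom_join[of x]
  by (simp_all add: eq_is_equal meet_comm[of L _ x] join_comm[of L _ \<bottom>])

lemma bounded_lattice_of_finite:
  assumes "lattice L" "finite (carrier L)" "carrier L \<noteq> {}"
  shows "bounded_lattice L"
proof -
  interpret lattice L by fact
  have "least L (\<Sqinter>\<^bsub>L\<^esub> carrier L) (carrier L)"
    using finite_inf_greatest[of "carrier L"] assms
    by (auto simp: least_def greatest_def Lower_def)
  moreover have "greatest L (\<Squnion>\<^bsub>L\<^esub> carrier L) (carrier L)"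
    using finite_sup_least[of "carrier L"] assms
    by (auto simp: least_def greatest_def Upper_def)
  ultimately show ?thesis
    by unfold_locales auto
qed

lemma (in bounded_lattice) finite_sup_lub:
  assumes "finite S" "S \<subseteq> carrier L"
  shows "least L (\<Squnion> S) (Upper L S)"
proof (cases "S = {}")
  case True
  then have "\<Squnion> S = \<bottom>" by (simp add: Lattice.sup_def bottom_def)
  with True show ?thesis using bottom_least by simp
qed (use assms finite_sup_least in auto)

lemma (in bounded_lattice) finite_sup_in_carrier:
  "finite S \<Longrightarrow> S \<subseteq> carrier L \<Longrightarrow> \<Squnion> S \<in> carrier L"
  using finite_sup_lub least_closed by metis

lemma (in bounded_lattice) finite_sup_le_iff:
  assumes "finite S" "S \<subseteq> carrier L" "z \<in> carrier L"
  shows "\<Squnion> S \<sqsubseteq> z \<longleftrightarrow> (\<forall>s\<in>S. s \<sqsubseteq> z)"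
proof
  assume le: "\<Squnion> S \<sqsubseteq> z"
  show "\<forall>s\<in>S. s \<sqsubseteq> z"
  proof
    fix s assume "s \<in> S"
    then have "s \<sqsubseteq> \<Squnion> S" "s \<in> carrier L"
      using least_Upper_above[OF finite_sup_lub] assms by auto
    then show "s \<sqsubseteq> z"
      using le le_trans[of s "\<Squnion> S" z] finite_sup_in_carrier[of S] assms by simp
  qed
next
  assume "\<forall>s\<in>S. s \<sqsubseteq> z"
  then have "z \<in> Upper L S" using assms by (auto simp: Upper_def)
  then show "\<Squnion> S \<sqsubseteq> z" using least_le[OF finite_sup_lub] assms by simp
qed

lemma lattice_isoI:
  assumes "lattice M" "lattice N" and f: "bij_betw f (carrier M) (carrier N)"
    and le: "\<And>x y. x \<in> carrier M \<Longrightarrow> y \<in> carrier M \<Longrightarrow> f x \<sqsubseteq>\<^bsub>N\<^esub> f y \<longleftrightarrow> x \<sqsubseteq>\<^bsub>M\<^esub> y"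
  shows "f \<in> lattice_iso M N"
proof -
  interpret M: lattice M by fact
  interpret N: lattice N by fact
  have mem: "f x \<in> carrier N" if "x \<in> carrier M" for x
    using that f by (meson bij_betwE)
  have surj: "\<exists>x\<in>carrier M. z = f x" if "z \<in> carrier N" for z
    using that f by (auto simp: bij_betw_def)
  have "f (x \<squnion>\<^bsub>M\<^esub> y) = f x \<squnion>\<^bsub>N\<^esub> f y" if "x \<in> carrier M" "y \<in> carrier M" for x y
  proof (rule N.eq_if_same_upper_bounds)
    fix z assume "z \<in> carrier N"
    then obtain w where "w \<in> carrier M" "z = f w" using surj by blast
    then show "f (x \<squnion>\<^bsub>M\<^esub> y) \<sqsubseteq>\<^bsub>N\<^esub> z \<longleftrightarrow> f x \<squnion>\<^bsub>N\<^esub> f y \<sqsubseteq>\<^bsub>N\<^esub> z"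
      using that by (simp add: le mem M.join_le_iff N.join_le_iff)
  qed (use that mem in auto)
  moreover have "f (x \<sqinter>\<^bsub>M\<^esub> y) = f x \<sqinter>\<^bsub>N\<^esub> f y" if "x \<in> carrier M" "y \<in> carrier M" for x y
  proof (rule N.eq_if_same_lower_bounds)
    fix z assume "z \<in> carrier N"
    then obtain w where "w \<in> carrier M" "z = f w" using surj by blast
    then show "z \<sqsubseteq>\<^bsub>N\<^esub> f (x \<sqinter>\<^bsub>M\<^esub> y) \<longleftrightarrow> z \<sqsubseteq>\<^bsub>N\<^esub> f x \<sqinter>\<^bsub>N\<^esub> f y"
      using that by (simp add: le mem M.le_meet_iff N.le_meet_iff)
  qed (use that mem in auto)
  ultimately show ?thesis
    using assms by (simp add: lattice_iso_def join_pres_def meet_pres_def)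
qed

lemma lattice_isoD:
  assumes "f \<in> lattice_iso M N"
  shows "bij_betw f (carrier M) (carrier N)" "lattice M" "lattice N"
    and "x \<in> carrier M \<Longrightarrow> f x \<in> carrier N"
    and "x \<in> carrier M \<Longrightarrow> y \<in> carrier M \<Longrightarrow> f (x \<squnion>\<^bsub>M\<^esub> y) = f x \<squnion>\<^bsub>N\<^esub> f y"
    and "x \<in> carrier M \<Longrightarrow> y \<in> carrier M \<Longrightarrow> f (x \<sqinter>\<^bsub>M\<^esub> y) = f x \<sqinter>\<^bsub>N\<^esub> f y"
  using assms by (auto simp: lattice_iso_def join_pres_def meet_pres_def bij_betwE)

lemma bij_join_pres_le_iff:
  assumes f: "bij_betw f (carrier M) (carrier N)" "join_pres M N f"
    and "x \<in> carrier M" "y \<in> carrier M"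
  shows "f x \<sqsubseteq>\<^bsub>N\<^esub> f y \<longleftrightarrow> x \<sqsubseteq>\<^bsub>M\<^esub> y"
proof -
  interpret M: lattice M using f by (simp add: join_pres_def)
  interpret N: lattice N using f by (simp add: join_pres_def)
  have mem: "f x \<in> carrier N" "f y \<in> carrier N" "x \<squnion>\<^bsub>M\<^esub> y \<in> carrier M"
    using assms by (auto simp: bij_betwE)
  have "f x \<sqsubseteq>\<^bsub>N\<^esub> f y \<longleftrightarrow> f (x \<squnion>\<^bsub>M\<^esub> y) = f y"
    using assms mem by (simp add: N.le_iff_meet join_pres_def)
  also have "\<dots> \<longleftrightarrow> x \<squnion>\<^bsub>M\<^esub> y = y"
    using assms mem inj_on_eq_iff[of f "carrier M" "x \<squnion>\<^bsub>M\<^esub> y" y] by (auto simp: bij_betw_def)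
  finally show ?thesis using assms by (simp add: M.le_iff_meet)
qed

lemma lattice_iso_le_iff:
  assumes "f \<in> lattice_iso M N" "x \<in> carrier M" "y \<in> carrier M"
  shows "f x \<sqsubseteq>\<^bsub>N\<^esub> f y \<longleftrightarrow> x \<sqsubseteq>\<^bsub>M\<^esub> y"
  using assms by (intro bij_join_pres_le_iff) (auto simp: lattice_iso_def)

lemma bij_join_pres_lattice_iso:
  assumes "bij_betw f (carrier M) (carrier N)" "join_pres M N f"
  shows "f \<in> lattice_iso M N"
  using assms bij_join_pres_le_iff[OF assms] by (intro lattice_isoI) (auto simp: join_pres_def)

lemma lattice_iso_inv_into:
  assumes "f \<in> lattice_iso M N"
  shows "inv_into (carrier M) f \<in> lattice_iso N M"
proof (rule lattice_isoI)
  let ?g = "inv_into (carrier M) f"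
  note bij = lattice_isoD(1)[OF assms]
  show "bij_betw ?g (carrier N) (carrier M)" using bij by (rule bij_betw_inv_into)
  fix x y assume xy: "x \<in> carrier N" "y \<in> carrier N"
  then have "?g x \<in> carrier M" "?g y \<in> carrier M" "f (?g x) = x" "f (?g y) = y"
    using bij by (auto simp: bij_betw_def f_inv_into_f inv_into_into)
  then show "?g x \<sqsubseteq>\<^bsub>M\<^esub> ?g y \<longleftrightarrow> x \<sqsubseteq>\<^bsub>N\<^esub> y"
    using lattice_iso_le_iff[OF assms] by metis
qed (use lattice_isoD[OF assms] in auto)

lemma lattice_iso_comp:
  assumes f: "f \<in> lattice_iso M N" and g: "g \<in> lattice_iso N P"
  shows "g \<circ> f \<in> lattice_iso M P"
proof (rule lattice_isoI)
  show "bij_betw (g \<circ> f) (carrier M) (carrier P)"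
    using lattice_isoD(1)[OF f] lattice_isoD(1)[OF g] by (rule bij_betw_trans)
  show "(g \<circ> f) x \<sqsubseteq>\<^bsub>P\<^esub> (g \<circ> f) y \<longleftrightarrow> x \<sqsubseteq>\<^bsub>M\<^esub> y" if "x \<in> carrier M" "y \<in> carrier M" for x y
    using that lattice_isoD(4)[OF f] lattice_iso_le_iff[OF f] lattice_iso_le_iff[OF g] by simp
qed (use lattice_isoD[OF f] lattice_isoD[OF g] in auto)

lemma lattice_iso_bottom:
  assumes "f \<in> lattice_iso M N" "bounded_lattice M" "bounded_lattice N"
  shows "f \<bottom>\<^bsub>M\<^esub> = \<bottom>\<^bsub>N\<^esub>"
proof -
  interpret M: bounded_lattice M by fact
  interpret N: bounded_lattice N by fact
  show ?thesis
  proof (rule N.bottom_eq)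
    show "f \<bottom>\<^bsub>M\<^esub> \<in> carrier N" using lattice_isoD(4)[OF assms(1)] by simp
    fix y assume "y \<in> carrier N"
    then obtain x where "x \<in> carrier M" "y = f x"
      using lattice_isoD(1)[OF assms(1)] by (metis bij_betw_def imageE)
    then show "f \<bottom>\<^bsub>M\<^esub> \<sqsubseteq>\<^bsub>N\<^esub> y" using lattice_iso_le_iff[OF assms(1)] by simp
  qed
qed

lemma product_lattice_simps:
  "carrier (product_lattice K M) = (\<Pi>\<^sub>E k\<in>K. carrier (M k))"
  "eq (product_lattice K M) = (=)"
  "x \<sqsubseteq>\<^bsub>product_lattice K M\<^esub> y \<longleftrightarrow> (\<forall>k\<in>K. x k \<sqsubseteq>\<^bsub>M k\<^esub> y k)"
  by (simp_all add: product_lattice_def)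

lemma product_partial_order:
  assumes "\<And>k. k \<in> K \<Longrightarrow> lattice (M k)"
  shows "partial_order (product_lattice K M)"
proof -
  have po: "partial_order (M k)" "weak_partial_order (M k)" if "k \<in> K" for k
    using assms[OF that]
    by (auto simp: lattice_def upper_semilattice_def partial_order_def)
  show ?thesis
  proof (unfold_locales, simp_all add: product_lattice_simps)
    show "\<forall>k\<in>K. x k \<sqsubseteq>\<^bsub>M k\<^esub> x k" if "x \<in> (\<Pi>\<^sub>E k\<in>K. carrier (M k))" for x
      using that po weak_partial_order.le_refl by fastforce
    show "x = y" if "\<forall>k\<in>K. x k \<sqsubseteq>\<^bsub>M k\<^esub> y k" "\<forall>k\<in>K. y k \<sqsubseteq>\<^bsub>M k\<^esub> x k"
      "x \<in> (\<Pi>\<^sub>E k\<in>K. carrier (M k))" "y \<in> (\<Pi>\<^sub>E k\<in>K. carrier (M k))" for x y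
      using that po by (intro PiE_ext) (auto intro!: partial_order.le_antisym dest: PiE_mem)
    show "\<forall>k\<in>K. x k \<sqsubseteq>\<^bsub>M k\<^esub> z k" if "\<forall>k\<in>K. x k \<sqsubseteq>\<^bsub>M k\<^esub> y k" "\<forall>k\<in>K. y k \<sqsubseteq>\<^bsub>M k\<^esub> z k"
      "x \<in> (\<Pi>\<^sub>E k\<in>K. carrier (M k))" "y \<in> (\<Pi>\<^sub>E k\<in>K. carrier (M k))"
      "z \<in> (\<Pi>\<^sub>E k\<in>K. carrier (M k))" for x y z
      using that po by (meson PiE_mem weak_partial_order.le_trans)
  qed
qed

lemma product_join_meet_bounds:
  assumes M: "\<And>k. k \<in> K \<Longrightarrow> lattice (M k)"
    and x: "x \<in> carrier (product_lattice K M)" and y: "y \<in> carrier (product_lattice K M)"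
  shows "least (product_lattice K M) (\<lambda>k\<in>K. x k \<squnion>\<^bsub>M k\<^esub> y k) (Upper (product_lattice K M) {x, y})"
    and "greatest (product_lattice K M) (\<lambda>k\<in>K. x k \<sqinter>\<^bsub>M k\<^esub> y k) (Lower (product_lattice K M) {x, y})"
proof -
  have mem: "x k \<in> carrier (M k)" "y k \<in> carrier (M k)" if "k \<in> K" for k
    using that x y by (auto simp: product_lattice_simps dest: PiE_mem)
  have U: "upper_semilattice (M k)" "weak_upper_semilattice (M k)"
    "lower_semilattice (M k)" "weak_lower_semilattice (M k)" if "k \<in> K" for k
  proof -
    interpret lattice "M k" using M[OF that] .
    show "upper_semilattice (M k)" "weak_upper_semilattice (M k)"
      "lower_semilattice (M k)" "weak_lower_semilattice (M k)" by unfold_locales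
  qed
  show "least (product_lattice K M) (\<lambda>k\<in>K. x k \<squnion>\<^bsub>M k\<^esub> y k) (Upper (product_lattice K M) {x, y})"
    using x y mem U
    by (intro least_UpperI)
       (auto simp: product_lattice_simps Upper_def PiE_iff upper_semilattice.join_le_iff
         intro: weak_upper_semilattice.join_closed weak_upper_semilattice.join_left
           weak_upper_semilattice.join_right)
  show "greatest (product_lattice K M) (\<lambda>k\<in>K. x k \<sqinter>\<^bsub>M k\<^esub> y k) (Lower (product_lattice K M) {x, y})"
    using x y mem U
    by (intro greatest_LowerI)
       (auto simp: product_lattice_simps Lower_def PiE_iff lower_semilattice.le_meet_iff
         intro: weak_lower_semilattice.meet_closed weak_lower_semilattice.meet_left
           weak_lower_semilattice.meet_right)
qed

lemma lattice_product:
  assumes "\<And>k. k \<in> K \<Longrightarrow> lattice (M k)"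
  shows "lattice (product_lattice K M)"
proof -
  interpret partial_order "product_lattice K M" using assms by (rule product_partial_order)
  show ?thesis
  proof unfold_locales
    fix x y assume xy: "x \<in> carrier (product_lattice K M)" "y \<in> carrier (product_lattice K M)"
    show "\<exists>s. least (product_lattice K M) s (Upper (product_lattice K M) {x, y})"
      by (rule exI, rule product_join_meet_bounds(1)) (use assms xy in auto)
    show "\<exists>s. greatest (product_lattice K M) s (Lower (product_lattice K M) {x, y})"
      by (rule exI, rule product_join_meet_bounds(2)) (use assms xy in auto)
  qed
qed

lemma product_join:
  assumes "\<And>k. k \<in> K \<Longrightarrow> lattice (M k)"
    and "x \<in> carrier (product_lattice K M)" "y \<in> carrier (product_lattice K M)" "k \<in> K"
  shows "(x \<squnion>\<^bsub>product_lattice K M\<^esub> y) k = x k \<squnion>\<^bsub>M k\<^esub> y k"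
proof -
  interpret lattice "product_lattice K M" using assms(1) by (rule lattice_product)
  have "x \<squnion>\<^bsub>product_lattice K M\<^esub> y = (\<lambda>k\<in>K. x k \<squnion>\<^bsub>M k\<^esub> y k)"
    by (rule least_unique[OF sup_of_two_least[folded join_def] product_join_meet_bounds(1)]) (use assms in auto)
  then show ?thesis using assms by simp
qed

lemma product_meet:
  assumes "\<And>k. k \<in> K \<Longrightarrow> lattice (M k)"
    and "x \<in> carrier (product_lattice K M)" "y \<in> carrier (product_lattice K M)" "k \<in> K"
  shows "(x \<sqinter>\<^bsub>product_lattice K M\<^esub> y) k = x k \<sqinter>\<^bsub>M k\<^esub> y k"
proof -
  interpret lattice "product_lattice K M" using assms(1) by (rule lattice_product)
  have "x \<sqinter>\<^bsub>product_lattice K M\<^esub> y = (\<lambda>k\<in>K. x k \<sqinter>\<^bsub>M k\<^esub> y k)"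
    by (rule greatest_unique[OF inf_of_two_greatest[folded meet_def] product_join_meet_bounds(2)]) (use assms in auto)
  then show ?thesis using assms by simp
qed

lemma curry_lattice_iso:
  assumes L: "\<And>t. t \<in> T \<Longrightarrow> lattice (L t)"
  shows "(\<lambda>x. \<lambda>(t, i)\<in>T \<times> I. x i t) \<in>
    lattice_iso (product_lattice I (\<lambda>_. product_lattice T L)) (product_lattice (T \<times> I) (\<lambda>p. L (fst p)))"
proof (rule lattice_isoI)
  show "lattice (product_lattice I (\<lambda>_. product_lattice T L))"
    "lattice (product_lattice (T \<times> I) (\<lambda>p. L (fst p)))"
    using L by (auto intro!: lattice_product)
  show "bij_betw (\<lambda>x. \<lambda>(t, i)\<in>T \<times> I. x i t) (carrier (product_lattice I (\<lambda>_. product_lattice T L)))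
      (carrier (product_lattice (T \<times> I) (\<lambda>p. L (fst p))))"
    unfolding product_lattice_simps
  proof (rule bij_betw_byWitness[where f' = "\<lambda>z. \<lambda>i\<in>I. \<lambda>t\<in>T. z (t, i)"])
    show "\<forall>x\<in>I \<rightarrow>\<^sub>E (\<Pi>\<^sub>E t\<in>T. carrier (L t)).
        (\<lambda>i\<in>I. \<lambda>t\<in>T. (\<lambda>(t, i)\<in>T \<times> I. x i t) (t, i)) = x"
    proof
      fix x assume x: "x \<in> I \<rightarrow>\<^sub>E (\<Pi>\<^sub>E t\<in>T. carrier (L t))"
      show "(\<lambda>i\<in>I. \<lambda>t\<in>T. (\<lambda>(t, i)\<in>T \<times> I. x i t) (t, i)) = x"
      proof (rule extensionalityI)
        fix i assume i: "i \<in> I"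
        then have "x i \<in> extensional T" using x by (simp add: PiE_iff)
        with i show "(\<lambda>i\<in>I. \<lambda>t\<in>T. (\<lambda>(t, i)\<in>T \<times> I. x i t) (t, i)) i = x i"
          by (intro extensionalityI[of _ T]) simp_all
      qed (use x in \<open>simp_all add: PiE_iff\<close>)
    qed
    show "\<forall>z\<in>\<Pi>\<^sub>E p\<in>T \<times> I. carrier (L (fst p)).
        (\<lambda>(t, i)\<in>T \<times> I. (\<lambda>i\<in>I. \<lambda>t\<in>T. z (t, i)) i t) = z"
      by (auto intro!: extensionalityI[of _ "T \<times> I"] simp: PiE_iff)
  qed (auto simp: PiE_iff split: if_splits)
qed (auto simp: product_lattice_simps)

locale bounded_family =
  fixes K :: "'k set" and M :: "'k \<Rightarrow> 'a gorder"
  assumes bounded: "k \<in> K \<Longrightarrow> bounded_lattice (M k)"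
begin

abbreviation "P \<equiv> product_lattice K M"

lemma factor_lattice: "k \<in> K \<Longrightarrow> lattice (M k)"
  using bounded by (simp add: bounded_lattice_def)

lemma carrierD: "x \<in> carrier P \<Longrightarrow> k \<in> K \<Longrightarrow> x k \<in> carrier (M k)"
  by (auto simp: product_lattice_simps)

lemma carrier_upd: "x \<in> carrier P \<Longrightarrow> k \<in> K \<Longrightarrow> a \<in> carrier (M k) \<Longrightarrow> x(k := a) \<in> carrier P"
  by (auto simp: product_lattice_simps PiE_iff extensional_def)

lemma carrier_eqI:
  "x \<in> carrier P \<Longrightarrow> y \<in> carrier P \<Longrightarrow> (\<And>k. k \<in> K \<Longrightarrow> x k = y k) \<Longrightarrow> x = y"
  by (auto simp: product_lattice_simps intro: PiE_ext)

lemma bottom_factor_closed: "k \<in> K \<Longrightarrow> \<bottom>\<^bsub>M k\<^esub> \<in> carrier (M k)"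
  and top_factor_closed: "k \<in> K \<Longrightarrow> \<top>\<^bsub>M k\<^esub> \<in> carrier (M k)"
  and bottom_factor_lower: "k \<in> K \<Longrightarrow> a \<in> carrier (M k) \<Longrightarrow> \<bottom>\<^bsub>M k\<^esub> \<sqsubseteq>\<^bsub>M k\<^esub> a"
  and top_factor_higher: "k \<in> K \<Longrightarrow> a \<in> carrier (M k) \<Longrightarrow> a \<sqsubseteq>\<^bsub>M k\<^esub> \<top>\<^bsub>M k\<^esub>"
proof -
  assume "k \<in> K"
  then interpret bounded_lattice "M k" by (rule bounded)
  show "\<bottom>\<^bsub>M k\<^esub> \<in> carrier (M k)" "\<top>\<^bsub>M k\<^esub> \<in> carrier (M k)"
    "a \<in> carrier (M k) \<Longrightarrow> \<bottom>\<^bsub>M k\<^esub> \<sqsubseteq>\<^bsub>M k\<^esub> a" "a \<in> carrier (M k) \<Longrightarrow> a \<sqsubseteq>\<^bsub>M k\<^esub> \<top>\<^bsub>M k\<^esub>"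
    by simp_all
qed

sublocale P: bounded_lattice P
proof -
  interpret lattice P by (rule lattice_product) (rule factor_lattice)
  have "least P (\<lambda>k\<in>K. \<bottom>\<^bsub>M k\<^esub>) (carrier P)"
    by (auto simp: product_lattice_simps least_def PiE_iff bottom_factor_closed intro: bottom_factor_lower)
  moreover have "greatest P (\<lambda>k\<in>K. \<top>\<^bsub>M k\<^esub>) (carrier P)"
    by (auto simp: product_lattice_simps greatest_def PiE_iff top_factor_closed intro: top_factor_higher)
  ultimately show "bounded_lattice P" by unfold_locales blast+
qed

lemma bottom_product: "k \<in> K \<Longrightarrow> \<bottom>\<^bsub>P\<^esub> k = \<bottom>\<^bsub>M k\<^esub>"
proof -
  have "least P (\<lambda>k\<in>K. \<bottom>\<^bsub>M k\<^esub>) (carrier P)"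
    by (auto simp: product_lattice_simps least_def PiE_iff bottom_factor_closed intro: bottom_factor_lower)
  then have "\<bottom>\<^bsub>P\<^esub> = (\<lambda>k\<in>K. \<bottom>\<^bsub>M k\<^esub>)" using P.bottom_least P.least_unique by blast
  then show "k \<in> K \<Longrightarrow> \<bottom>\<^bsub>P\<^esub> k = \<bottom>\<^bsub>M k\<^esub>" by simp
qed

lemma top_product: "k \<in> K \<Longrightarrow> \<top>\<^bsub>P\<^esub> k = \<top>\<^bsub>M k\<^esub>"
proof -
  have "greatest P (\<lambda>k\<in>K. \<top>\<^bsub>M k\<^esub>) (carrier P)"
    by (auto simp: product_lattice_simps greatest_def PiE_iff top_factor_closed intro: top_factor_higher)
  then have "\<top>\<^bsub>P\<^esub> = (\<lambda>k\<in>K. \<top>\<^bsub>M k\<^esub>)" using P.top_greatest P.greatest_unique by blast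
  then show "k \<in> K \<Longrightarrow> \<top>\<^bsub>P\<^esub> k = \<top>\<^bsub>M k\<^esub>" by simp
qed

lemma join_product:
  "x \<in> carrier P \<Longrightarrow> y \<in> carrier P \<Longrightarrow> k \<in> K \<Longrightarrow> (x \<squnion>\<^bsub>P\<^esub> y) k = x k \<squnion>\<^bsub>M k\<^esub> y k"
  and meet_product:
  "x \<in> carrier P \<Longrightarrow> y \<in> carrier P \<Longrightarrow> k \<in> K \<Longrightarrow> (x \<sqinter>\<^bsub>P\<^esub> y) k = x k \<sqinter>\<^bsub>M k\<^esub> y k"
  by (rule product_join product_meet; use factor_lattice in blast)+

definition embed :: "'k \<Rightarrow> 'a \<Rightarrow> 'k \<Rightarrow> 'a" where
  "embed k a = \<bottom>\<^bsub>P\<^esub>(k := a)"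

definition coembed :: "'k \<Rightarrow> 'a \<Rightarrow> 'k \<Rightarrow> 'a" where
  "coembed k a = \<top>\<^bsub>P\<^esub>(k := a)"

lemma embed_closed: "k \<in> K \<Longrightarrow> a \<in> carrier (M k) \<Longrightarrow> embed k a \<in> carrier P"
  unfolding embed_def by (rule carrier_upd[OF P.bottom_closed])

lemma coembed_closed: "k \<in> K \<Longrightarrow> a \<in> carrier (M k) \<Longrightarrow> coembed k a \<in> carrier P"
  unfolding coembed_def by (rule carrier_upd[OF P.top_closed])

lemma embed_apply: "j \<in> K \<Longrightarrow> embed k a j = (if j = k then a else \<bottom>\<^bsub>M j\<^esub>)"
  by (simp add: embed_def bottom_product)

lemma coembed_apply: "j \<in> K \<Longrightarrow> coembed k a j = (if j = k then a else \<top>\<^bsub>M j\<^esub>)"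
  by (simp add: coembed_def top_product)

lemma embed_le_iff:
  assumes "k \<in> K" "x \<in> carrier P"
  shows "embed k a \<sqsubseteq>\<^bsub>P\<^esub> x \<longleftrightarrow> a \<sqsubseteq>\<^bsub>M k\<^esub> x k"
  using assms bottom_factor_lower by (auto simp: product_lattice_simps(3) embed_apply carrierD)

lemma le_coembed_iff:
  assumes "k \<in> K" "x \<in> carrier P"
  shows "x \<sqsubseteq>\<^bsub>P\<^esub> coembed k a \<longleftrightarrow> x k \<sqsubseteq>\<^bsub>M k\<^esub> a"
  using assms top_factor_higher by (auto simp: product_lattice_simps(3) coembed_apply carrierD)

lemma le_embed_top_imp_eq:
  assumes "k \<in> K" "x \<in> carrier P" "x \<sqsubseteq>\<^bsub>P\<^esub> embed k \<top>\<^bsub>M k\<^esub>"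
  shows "x = embed k (x k)"
proof (rule carrier_eqI)
  show "x \<in> carrier P" by fact
  show "embed k (x k) \<in> carrier P" using assms by (simp add: embed_closed carrierD)
  fix j assume j: "j \<in> K"
  have "x j \<sqsubseteq>\<^bsub>M j\<^esub> embed k \<top>\<^bsub>M k\<^esub> j" using assms j by (simp add: product_lattice_simps)
  moreover have "x j \<in> carrier (M j)" using assms j by (simp add: carrierD)
  ultimately show "x j = embed k (x k) j"
    using j bounded_lattice.le_bottom_iff[OF bounded[OF j]] by (auto simp: embed_apply)
qed

end

section \<open>Unique factorisation into irreducible lattices\<close>

definition ideal_below :: "'a gorder \<Rightarrow> 'a \<Rightarrow> 'a gorder" where
  "ideal_below L c = L\<lparr>carrier := {x \<in> carrier L. x \<sqsubseteq>\<^bsub>L\<^esub> c}\<rparr>"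

lemma ideal_below_simps [simp]:
  "x \<in> carrier (ideal_below L c) \<longleftrightarrow> x \<in> carrier L \<and> x \<sqsubseteq>\<^bsub>L\<^esub> c"
  "eq (ideal_below L c) = eq L" "le (ideal_below L c) = le L"
  by (simp_all add: ideal_below_def)

lemma lattice_ideal_below:
  fixes L :: "'a gorder" (structure)
  assumes "lattice L" "c \<in> carrier L"
  shows "lattice (ideal_below L c)"
proof -
  interpret lattice L by fact
  let ?I = "ideal_below L c"
  have "partial_order ?I"
    unfolding ideal_below_def partial_order_def partial_order_axioms_def
    using weak_partial_order_subset[OF weak_partial_order_axioms] eq_is_equal by auto
  then interpret I: partial_order ?I .
  show ?thesis
  proof unfold_locales
    fix x y assume xy: "x \<in> carrier ?I" "y \<in> carrier ?I"
    have "least ?I (x \<squnion> y) (Upper ?I {x, y})"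
      using xy assms(2) by (intro least_UpperI) (auto simp: Upper_def join_le_iff join_left join_right)
    then show "\<exists>s. least ?I s (Upper ?I {x, y})" by blast
    have "x \<sqinter> y \<sqsubseteq> c"
      using xy assms(2) le_trans[of "x \<sqinter> y" x c] by (simp add: meet_left)
    then have "greatest ?I (x \<sqinter> y) (Lower ?I {x, y})"
      using xy assms(2) by (intro greatest_LowerI) (auto simp: Lower_def le_meet_iff meet_left meet_right)
    then show "\<exists>s. greatest ?I s (Lower ?I {x, y})" by blast
  qed
qed

lemma lattice_binary_product:
  assumes "lattice M" "lattice N"
  shows "lattice (binary_product M N)"
proof -
  interpret M: lattice M by fact
  interpret N: lattice N by fact
  let ?P = "binary_product M N"
  have [simp]: "carrier ?P = carrier M \<times> carrier N" "eq ?P = (=)"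
    "\<And>x y. x \<sqsubseteq>\<^bsub>?P\<^esub> y \<longleftrightarrow> fst x \<sqsubseteq>\<^bsub>M\<^esub> fst y \<and> snd x \<sqsubseteq>\<^bsub>N\<^esub> snd y"
    by (auto simp: binary_product_def)
  interpret P: partial_order ?P
    by unfold_locales (auto simp: prod_eq_iff intro: M.le_trans N.le_trans)
  show ?thesis
  proof unfold_locales
    fix x y assume xy: "x \<in> carrier ?P" "y \<in> carrier ?P"
    have "least ?P (fst x \<squnion>\<^bsub>M\<^esub> fst y, snd x \<squnion>\<^bsub>N\<^esub> snd y) (Upper ?P {x, y})"
      using xy
      by (intro least_UpperI)
        (auto simp: Upper_def M.join_le_iff N.join_le_iff M.join_left M.join_right N.join_left N.join_right)
    then show "\<exists>s. least ?P s (Upper ?P {x, y})" by blast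
    have "greatest ?P (fst x \<sqinter>\<^bsub>M\<^esub> fst y, snd x \<sqinter>\<^bsub>N\<^esub> snd y) (Lower ?P {x, y})"
      using xy
      by (intro greatest_LowerI)
        (auto simp: Lower_def M.le_meet_iff N.le_meet_iff M.meet_left M.meet_right N.meet_left N.meet_right)
    then show "\<exists>s. greatest ?P s (Lower ?P {x, y})" by blast
  qed
qed

text \<open>
  \<open>x \<mapsto> (x \<sqinter> c, x \<sqinter> d)\<close> and \<open>(u, v) \<mapsto> u \<squnion> v\<close> are mutually inverse isomorphisms between \<open>L\<close> and the
  product of the principal ideals of \<open>c\<close> and \<open>d\<close>.
\<close>

definition factor_pair :: "'a gorder \<Rightarrow> 'a \<Rightarrow> 'a \<Rightarrow> bool" where
  "factor_pair L c d \<longleftrightarrow> c \<in> carrier L \<and> d \<in> carrier L \<and>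
     (\<forall>x\<in>carrier L. (x \<sqinter>\<^bsub>L\<^esub> c) \<squnion>\<^bsub>L\<^esub> (x \<sqinter>\<^bsub>L\<^esub> d) = x) \<and>
     (\<forall>u\<in>carrier L. \<forall>v\<in>carrier L. u \<sqsubseteq>\<^bsub>L\<^esub> c \<longrightarrow> v \<sqsubseteq>\<^bsub>L\<^esub> d \<longrightarrow>
        (u \<squnion>\<^bsub>L\<^esub> v) \<sqinter>\<^bsub>L\<^esub> c = u \<and> (u \<squnion>\<^bsub>L\<^esub> v) \<sqinter>\<^bsub>L\<^esub> d = v)"

lemma factor_pairD:
  fixes L :: "'a gorder" (structure)
  assumes "factor_pair L c d"
  shows "c \<in> carrier L" "d \<in> carrier L"
    and "x \<in> carrier L \<Longrightarrow> (x \<sqinter> c) \<squnion> (x \<sqinter> d) = x"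
    and "\<lbrakk>u \<in> carrier L; v \<in> carrier L; u \<sqsubseteq> c; v \<sqsubseteq> d\<rbrakk> \<Longrightarrow> (u \<squnion> v) \<sqinter> c = u"
    and "\<lbrakk>u \<in> carrier L; v \<in> carrier L; u \<sqsubseteq> c; v \<sqsubseteq> d\<rbrakk> \<Longrightarrow> (u \<squnion> v) \<sqinter> d = v"
  using assms unfolding factor_pair_def by blast+

lemma irreducible_factor_pair:
  fixes L :: "'a gorder" (structure)
  assumes "bounded_lattice L" and irr: "irreducible_lattice L" and fp: "factor_pair L c d"
  shows "c = \<bottom>\<^bsub>L\<^esub> \<or> d = \<bottom>\<^bsub>L\<^esub>"
proof (rule ccontr)
  interpret bounded_lattice L by fact
  assume nb: "\<not> (c = \<bottom>\<^bsub>L\<^esub> \<or> d = \<bottom>\<^bsub>L\<^esub>)"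
  note cd [simp] = factor_pairD(1,2)[OF fp]
  note split = factor_pairD(3)[OF fp] and pair = factor_pairD(4,5)[OF fp]
  let ?C = "ideal_below L c" and ?D = "ideal_below L d"
  have lat: "lattice ?C" "lattice ?D"
    using lattice_ideal_below[OF lattice_axioms] by simp_all
  have "(\<lambda>x. (x \<sqinter> c, x \<sqinter> d)) \<in> lattice_iso L (binary_product ?C ?D)"
  proof (rule lattice_isoI)
    show "lattice (binary_product ?C ?D)" using lat by (rule lattice_binary_product)
    show "bij_betw (\<lambda>x. (x \<sqinter> c, x \<sqinter> d)) (carrier L) (carrier (binary_product ?C ?D))"
      by (rule bij_betw_byWitness[where f' = "\<lambda>(u, v). u \<squnion> v"])
        (auto simp: binary_product_def split pair meet_right)
    fix x y assume xy: "x \<in> carrier L" "y \<in> carrier L"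
    have "x \<sqsubseteq> y" if "x \<sqinter> c \<sqsubseteq> y \<sqinter> c" "x \<sqinter> d \<sqsubseteq> y \<sqinter> d"
    proof -
      have "(x \<sqinter> c) \<squnion> (x \<sqinter> d) \<sqsubseteq> y"
        using that xy by (simp add: join_le_iff le_meet_iff)
      then show ?thesis using xy split by simp
    qed
    moreover have "x \<sqinter> a \<sqsubseteq> y \<sqinter> a" if "x \<sqsubseteq> y" "a \<in> carrier L" for a
      using that xy le_trans[of "x \<sqinter> a" x y] by (simp add: le_meet_iff meet_left meet_right)
    ultimately show "(x \<sqinter> c, x \<sqinter> d) \<sqsubseteq>\<^bsub>binary_product ?C ?D\<^esub> (y \<sqinter> c, y \<sqinter> d) \<longleftrightarrow> x \<sqsubseteq> y"
      by (auto simp: binary_product_def)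
  qed (rule lattice_axioms)
  then have "lattice_iso L (binary_product ?C ?D) \<noteq> {}" by blast
  moreover have nontrivial: "\<exists>x\<in>carrier (ideal_below L a). \<exists>y\<in>carrier (ideal_below L a). x \<noteq> y"
    if "a \<in> carrier L" "a \<noteq> \<bottom>" for a
    using that by (intro bexI[of _ a] bexI[of _ "\<bottom>"]) auto
  have "\<exists>x\<in>carrier ?C. \<exists>y\<in>carrier ?C. x \<noteq> y" "\<exists>x\<in>carrier ?D. \<exists>y\<in>carrier ?D. x \<noteq> y"
    using nb by (auto intro!: nontrivial simp del: ideal_below_simps)
  ultimately show False
    using irr lat unfolding irreducible_lattice_def by metis
qed

lemma irreducible_factor_pair_top:
  fixes L :: "'a gorder" (structure)
  assumes "bounded_lattice L" "irreducible_lattice L" and fp: "factor_pair L c d"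
  shows "c = \<top>\<^bsub>L\<^esub> \<or> d = \<top>\<^bsub>L\<^esub>"
proof -
  interpret bounded_lattice L by fact
  note cd = factor_pairD(1,2)[OF fp]
  have "(\<top> \<sqinter> c) \<squnion> (\<top> \<sqinter> d) = \<top>" using fp by (rule factor_pairD) simp
  with cd have "c \<squnion> d = \<top>" by (simp add: meet_comm[of L \<top>])
  then show ?thesis using irreducible_factor_pair[OF assms] cd by auto
qed

lemma irreducible_top_neq_bottom:
  fixes L :: "'a gorder" (structure)
  assumes "bounded_lattice L" "irreducible_lattice L"
  shows "\<top>\<^bsub>L\<^esub> \<noteq> \<bottom>\<^bsub>L\<^esub>"
proof
  interpret bounded_lattice L by fact
  assume top: "\<top> = \<bottom>"
  have "x = \<bottom>" if "x \<in> carrier L" for x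
    using that top_higher[of x] by (simp add: top le_bottom_iff)
  then show False
    using assms(2) unfolding irreducible_lattice_def by metis
qed

lemma factor_pair_lattice_iso:
  assumes f: "f \<in> lattice_iso M N" and fp: "factor_pair M c d"
  shows "factor_pair N (f c) (f d)"
proof -
  interpret M: lattice M using lattice_isoD[OF f] by simp
  note D = lattice_isoD[OF f]
  note cd = factor_pairD(1,2)[OF fp]
  have img: "carrier N = f ` carrier M" using D(1) by (simp add: bij_betw_def)
  show ?thesis
    unfolding factor_pair_def img ball_simps
  proof (intro conjI ballI impI)
    fix x assume "x \<in> carrier M"
    then show "(f x \<sqinter>\<^bsub>N\<^esub> f c) \<squnion>\<^bsub>N\<^esub> (f x \<sqinter>\<^bsub>N\<^esub> f d) = f x"
      using cd by (simp flip: D(5,6) add: factor_pairD(3)[OF fp])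
  next
    fix u v assume uv: "u \<in> carrier M" "v \<in> carrier M" "f u \<sqsubseteq>\<^bsub>N\<^esub> f c" "f v \<sqsubseteq>\<^bsub>N\<^esub> f d"
    then have "u \<sqsubseteq>\<^bsub>M\<^esub> c" "v \<sqsubseteq>\<^bsub>M\<^esub> d" using cd lattice_iso_le_iff[OF f] by auto
    then show "(f u \<squnion>\<^bsub>N\<^esub> f v) \<sqinter>\<^bsub>N\<^esub> f c = f u" "(f u \<squnion>\<^bsub>N\<^esub> f v) \<sqinter>\<^bsub>N\<^esub> f d = f v"
      using cd uv by (simp_all flip: D(5,6) add: factor_pairD(4,5)[OF fp])
  qed (use cd in auto)
qed

context bounded_family
begin

lemma factor_pair_component:
  assumes fp: "factor_pair P c d" and k: "k \<in> K"
  shows "factor_pair (M k) (c k) (d k)"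
proof -
  interpret Mk: bounded_lattice "M k" using k by (rule bounded)
  note cd = factor_pairD(1,2)[OF fp]
  note mem = carrierD[OF _ k]
  have "(a \<sqinter>\<^bsub>M k\<^esub> c k) \<squnion>\<^bsub>M k\<^esub> (a \<sqinter>\<^bsub>M k\<^esub> d k) = a" if a: "a \<in> carrier (M k)" for a
  proof -
    let ?x = "embed k a"
    have x: "?x \<in> carrier P" using a k by (rule embed_closed[rotated])
    have "((?x \<sqinter>\<^bsub>P\<^esub> c) \<squnion>\<^bsub>P\<^esub> (?x \<sqinter>\<^bsub>P\<^esub> d)) k = ?x k" using factor_pairD(3)[OF fp x] by simp
    then show ?thesis using x cd k by (simp add: join_product meet_product embed_apply)
  qed
  moreover have "(u \<squnion>\<^bsub>M k\<^esub> v) \<sqinter>\<^bsub>M k\<^esub> c k = u \<and> (u \<squnion>\<^bsub>M k\<^esub> v) \<sqinter>\<^bsub>M k\<^esub> d k = v"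
    if uv: "u \<in> carrier (M k)" "v \<in> carrier (M k)" "u \<sqsubseteq>\<^bsub>M k\<^esub> c k" "v \<sqsubseteq>\<^bsub>M k\<^esub> d k" for u v
  proof -
    let ?u = "embed k u" and ?v = "embed k v"
    have mem': "?u \<in> carrier P" "?v \<in> carrier P" using uv k by (auto intro: embed_closed)
    have "?u \<sqsubseteq>\<^bsub>P\<^esub> c" "?v \<sqsubseteq>\<^bsub>P\<^esub> d" using uv k cd by (auto simp: embed_le_iff)
    then have "((?u \<squnion>\<^bsub>P\<^esub> ?v) \<sqinter>\<^bsub>P\<^esub> c) k = ?u k" "((?u \<squnion>\<^bsub>P\<^esub> ?v) \<sqinter>\<^bsub>P\<^esub> d) k = ?v k"
      using factor_pairD(4,5)[OF fp mem'] by simp_all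
    then show ?thesis using mem' cd k by (simp add: join_product meet_product embed_apply)
  qed
  ultimately show ?thesis using cd mem unfolding factor_pair_def by blast
qed

abbreviation "unit_at k \<equiv> embed k \<top>\<^bsub>M k\<^esub>"
abbreviation "counit_at k \<equiv> coembed k \<bottom>\<^bsub>M k\<^esub>"

lemma unit_at_closed: "k \<in> K \<Longrightarrow> unit_at k \<in> carrier P"
  by (simp add: embed_closed top_factor_closed)

lemma counit_at_closed: "k \<in> K \<Longrightarrow> counit_at k \<in> carrier P"
  by (simp add: coembed_closed bottom_factor_closed)

lemma factor_pair_unit_at:
  assumes k: "k \<in> K"
  shows "factor_pair P (unit_at k) (counit_at k)"
proof -
  note cl = unit_at_closed[OF k] counit_at_closed[OF k]
  have "(x \<sqinter>\<^bsub>P\<^esub> unit_at k) \<squnion>\<^bsub>P\<^esub> (x \<sqinter>\<^bsub>P\<^esub> counit_at k) = x" if x: "x \<in> carrier P" for x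
  proof (rule carrier_eqI)
    fix j assume j: "j \<in> K"
    interpret Mj: bounded_lattice "M j" using j by (rule bounded)
    show "((x \<sqinter>\<^bsub>P\<^esub> unit_at k) \<squnion>\<^bsub>P\<^esub> (x \<sqinter>\<^bsub>P\<^esub> counit_at k)) j = x j"
      using x cl j carrierD[OF x j]
      by (cases "k = j") (simp_all add: join_product meet_product embed_apply coembed_apply)
  qed (use x cl in auto)
  moreover have "(u \<squnion>\<^bsub>P\<^esub> v) \<sqinter>\<^bsub>P\<^esub> unit_at k = u \<and> (u \<squnion>\<^bsub>P\<^esub> v) \<sqinter>\<^bsub>P\<^esub> counit_at k = v"
    if uv: "u \<in> carrier P" "v \<in> carrier P" "u \<sqsubseteq>\<^bsub>P\<^esub> unit_at k" "v \<sqsubseteq>\<^bsub>P\<^esub> counit_at k" for u v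
  proof -
    have "((u \<squnion>\<^bsub>P\<^esub> v) \<sqinter>\<^bsub>P\<^esub> unit_at k) j = u j \<and> ((u \<squnion>\<^bsub>P\<^esub> v) \<sqinter>\<^bsub>P\<^esub> counit_at k) j = v j"
      if j: "j \<in> K" for j
    proof -
      interpret Mj: bounded_lattice "M j" using j by (rule bounded)
      have mem: "u j \<in> carrier (M j)" "v j \<in> carrier (M j)" using uv j by (auto intro: carrierD)
      have "u j \<sqsubseteq>\<^bsub>M j\<^esub> unit_at k j" "v j \<sqsubseteq>\<^bsub>M j\<^esub> counit_at k j"
        using uv j by (auto simp: product_lattice_simps)
      then show ?thesis
        using uv cl j mem
        by (cases "k = j")
          (simp_all add: join_product meet_product embed_apply coembed_apply Mj.le_bottom_iff)
    qed
    then show ?thesis using uv cl by (auto intro!: carrier_eqI)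
  qed
  ultimately show ?thesis using cl unfolding factor_pair_def by blast
qed

end

locale product_isomorphism = M: bounded_family K M + N: bounded_family J N
  for K :: "'k set" and M :: "'k \<Rightarrow> 'a gorder" and J :: "'j set" and N :: "'j \<Rightarrow> 'b gorder" +
  fixes f
  assumes iso: "f \<in> lattice_iso M.P N.P"
    and irreducible_source: "k \<in> K \<Longrightarrow> irreducible_lattice (M k)"
    and irreducible_target: "j \<in> J \<Longrightarrow> irreducible_lattice (N j)"
begin

abbreviation "g \<equiv> inv_into (carrier M.P) f"

lemma inverse: "g \<in> lattice_iso N.P M.P"
  using iso by (rule lattice_iso_inv_into)

lemma f_g: "y \<in> carrier N.P \<Longrightarrow> f (g y) = y"
  using lattice_isoD(1)[OF iso] by (simp add: bij_betw_def f_inv_into_f)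

lemma g_f: "x \<in> carrier M.P \<Longrightarrow> g (f x) = x"
  using lattice_isoD(1)[OF iso] by (simp add: bij_betw_def)

lemmas f_closed = lattice_isoD(4)[OF iso]
lemmas g_closed = lattice_isoD(4)[OF inverse]

lemma f_le_f: "x \<in> carrier M.P \<Longrightarrow> y \<in> carrier M.P \<Longrightarrow> f x \<sqsubseteq>\<^bsub>N.P\<^esub> f y \<longleftrightarrow> x \<sqsubseteq>\<^bsub>M.P\<^esub> y"
  using iso by (rule lattice_iso_le_iff)

lemma inverse_isomorphism: "product_isomorphism J N K M g"
  by unfold_locales (simp_all add: inverse irreducible_source irreducible_target)

lemma image_of_unit_dichotomy:
  assumes "k \<in> K" "j \<in> J"
  shows "f (M.unit_at k) j = \<top>\<^bsub>N j\<^esub> \<or> f (M.counit_at k) j = \<top>\<^bsub>N j\<^esub>"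
proof -
  interpret Nj: bounded_lattice "N j" using assms by (intro N.bounded)
  have "factor_pair (N j) (f (M.unit_at k) j) (f (M.counit_at k) j)"
    using factor_pair_lattice_iso[OF iso] M.factor_pair_unit_at N.factor_pair_component assms by blast
  then show ?thesis
    using irreducible_factor_pair_top[OF Nj.bounded_lattice_axioms irreducible_target] assms by blast
qed

lemma unit_below_image_of_unit:
  assumes j: "j \<in> J"
  shows "\<exists>k\<in>K. N.unit_at j \<sqsubseteq>\<^bsub>N.P\<^esub> f (M.unit_at k)"
proof (rule ccontr)
  assume neg: "\<not> ?thesis"
  interpret Nj: bounded_lattice "N j" using j by (rule N.bounded)
  note uj = N.unit_at_closed[OF j]
  have "g (N.unit_at j) k = \<bottom>\<^bsub>M k\<^esub>" if k: "k \<in> K" for k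
  proof -
    interpret Mk: bounded_lattice "M k" using k by (rule M.bounded)
    note cl = M.unit_at_closed[OF k] M.counit_at_closed[OF k]
    have "\<not> \<top>\<^bsub>N j\<^esub> \<sqsubseteq>\<^bsub>N j\<^esub> f (M.unit_at k) j"
      using neg k j cl f_closed by (auto simp: N.embed_le_iff)
    then have "f (M.counit_at k) j = \<top>\<^bsub>N j\<^esub>"
      using image_of_unit_dichotomy[OF k j] by auto
    then have "f (g (N.unit_at j)) \<sqsubseteq>\<^bsub>N.P\<^esub> f (M.counit_at k)"
      using uj j cl f_closed by (simp add: f_g N.embed_le_iff)
    then have "g (N.unit_at j) \<sqsubseteq>\<^bsub>M.P\<^esub> M.counit_at k"
      using uj cl g_closed f_le_f by simp
    then show ?thesis
      using k uj g_closed M.carrierD by (simp add: M.le_coembed_iff Mk.le_bottom_iff)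
  qed
  then have "g (N.unit_at j) = \<bottom>\<^bsub>M.P\<^esub>"
    using uj g_closed by (intro M.carrier_eqI) (auto simp: M.bottom_product)
  then have "N.unit_at j = \<bottom>\<^bsub>N.P\<^esub>"
    using f_g[OF uj] lattice_iso_bottom[OF iso M.P.bounded_lattice_axioms N.P.bounded_lattice_axioms]
    by simp
  then have "\<top>\<^bsub>N j\<^esub> = \<bottom>\<^bsub>N j\<^esub>"
    using j N.embed_apply[of j j] N.bottom_product by metis
  then show False
    using irreducible_top_neq_bottom[OF Nj.bounded_lattice_axioms irreducible_target] j by blast
qed

lemma unit_at_le_imp_eq:
  assumes "i \<in> J" "j \<in> J" "N.unit_at j \<sqsubseteq>\<^bsub>N.P\<^esub> N.unit_at i"
  shows "i = j"
proof (rule ccontr)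
  assume "i \<noteq> j"
  interpret Nj: bounded_lattice "N j" using assms(2) by (rule N.bounded)
  have "\<top>\<^bsub>N j\<^esub> = \<bottom>\<^bsub>N j\<^esub>"
    using assms \<open>i \<noteq> j\<close> N.unit_at_closed
    by (simp add: N.embed_le_iff N.embed_apply Nj.le_bottom_iff)
  then show False
    using irreducible_top_neq_bottom[OF Nj.bounded_lattice_axioms irreducible_target] assms by blast
qed

lemma units_match:
  assumes "j \<in> J"
  shows "\<exists>k\<in>K. f (M.unit_at k) = N.unit_at j"
proof -
  interpret inv: product_isomorphism J N K M g by (rule inverse_isomorphism)
  obtain k where k: "k \<in> K" and le: "N.unit_at j \<sqsubseteq>\<^bsub>N.P\<^esub> f (M.unit_at k)"
    using unit_below_image_of_unit[OF assms] by blast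
  obtain i where i: "i \<in> J" and le': "M.unit_at k \<sqsubseteq>\<^bsub>M.P\<^esub> g (N.unit_at i)"
    using inv.unit_below_image_of_unit[OF k] by blast
  note cl = N.unit_at_closed[OF assms] N.unit_at_closed[OF i] M.unit_at_closed[OF k]
  have le'': "f (M.unit_at k) \<sqsubseteq>\<^bsub>N.P\<^esub> N.unit_at i"
    using le' cl f_le_f[of "M.unit_at k" "g (N.unit_at i)"] by (simp add: f_g g_closed)
  have "N.unit_at j \<sqsubseteq>\<^bsub>N.P\<^esub> N.unit_at i"
    using le le'' cl f_closed by (meson N.P.le_trans)
  then have "i = j" using unit_at_le_imp_eq i assms by blast
  then have "f (M.unit_at k) = N.unit_at j"
    using le le'' cl f_closed by (intro N.P.le_antisym) auto
  with k show ?thesis by blast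
qed

theorem unique_factorisation:
  obtains \<rho> \<phi> where "bij_betw \<rho> J K"
    and "\<And>j. j \<in> J \<Longrightarrow> \<phi> j \<in> lattice_iso (M (\<rho> j)) (N j)"
    and "\<And>x j. x \<in> carrier M.P \<Longrightarrow> j \<in> J \<Longrightarrow> f x j = \<phi> j (x (\<rho> j))"
proof -
  interpret inv: product_isomorphism J N K M g by (rule inverse_isomorphism)
  obtain \<rho> where \<rho>: "\<And>j. j \<in> J \<Longrightarrow> \<rho> j \<in> K" "\<And>j. j \<in> J \<Longrightarrow> f (M.unit_at (\<rho> j)) = N.unit_at j"
    using units_match by metis
  define \<phi> where "\<phi> j a = f (M.embed (\<rho> j) a) j" for j a
  have "bij_betw \<rho> J K"
  proof (rule bij_betw_imageI)
    show "inj_on \<rho> J"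
    proof (rule inj_onI)
      fix i j assume ij: "i \<in> J" "j \<in> J" "\<rho> i = \<rho> j"
      then have "N.unit_at i = N.unit_at j" using \<rho>(2)[of i] \<rho>(2)[of j] by simp
      then show "i = j" using ij unit_at_le_imp_eq N.unit_at_closed by simp
    qed
    show "\<rho> ` J = K"
    proof (intro equalityI subsetI)
      fix k assume k: "k \<in> K"
      then obtain j where j: "j \<in> J" "g (N.unit_at j) = M.unit_at k"
        using inv.units_match by blast
      then have "M.unit_at (\<rho> j) = M.unit_at k"
        using \<rho>[of j] g_f[OF M.unit_at_closed, of "\<rho> j"] by simp
      then have "k = \<rho> j"
        using k j \<rho>(1) inv.unit_at_le_imp_eq M.unit_at_closed by simp
      then show "k \<in> \<rho> ` J" using j by blast
    qed (use \<rho> in auto)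
  qed
  moreover have "f x j = \<phi> j (x (\<rho> j))" if x: "x \<in> carrier M.P" and j: "j \<in> J" for x j
  proof -
    let ?k = "\<rho> j"
    note k = \<rho>(1)[OF j]
    note e = M.unit_at_closed[OF k]
    interpret Nj: bounded_lattice "N j" using j by (rule N.bounded)
    interpret Mk: bounded_lattice "M ?k" using k by (rule M.bounded)
    have "x \<sqinter>\<^bsub>M.P\<^esub> M.unit_at ?k = M.embed ?k ((x \<sqinter>\<^bsub>M.P\<^esub> M.unit_at ?k) ?k)"
      using x e k by (intro M.le_embed_top_imp_eq) (auto simp: M.P.meet_right)
    also have "(x \<sqinter>\<^bsub>M.P\<^esub> M.unit_at ?k) ?k = x ?k"
      using x e k M.carrierD[OF x k] by (simp add: M.meet_product M.embed_apply)
    finally have "\<phi> j (x ?k) = f (x \<sqinter>\<^bsub>M.P\<^esub> M.unit_at ?k) j"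
      by (simp add: \<phi>_def)
    also have "\<dots> = (f x \<sqinter>\<^bsub>N.P\<^esub> N.unit_at j) j"
      using lattice_isoD(6)[OF iso x e] \<rho>(2)[OF j] by simp
    also have "\<dots> = f x j"
      using f_closed[OF x] N.unit_at_closed j N.carrierD[OF f_closed[OF x] j]
      by (simp add: N.meet_product N.embed_apply)
    finally show ?thesis by simp
  qed
  moreover have "\<phi> j \<in> lattice_iso (M (\<rho> j)) (N j)" if j: "j \<in> J" for j
  proof -
    let ?k = "\<rho> j"
    note k = \<rho>(1)[OF j]
    note e = M.unit_at_closed[OF k]
    interpret Nj: bounded_lattice "N j" using j by (rule N.bounded)
    interpret Mk: bounded_lattice "M ?k" using k by (rule M.bounded)
    have emb: "M.embed ?k a \<in> carrier M.P" if "a \<in> carrier (M ?k)" for a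
      using that k by (rule M.embed_closed[rotated])
    have mem: "\<phi> j a \<in> carrier (N j)" if "a \<in> carrier (M ?k)" for a
      unfolding \<phi>_def using N.carrierD[OF f_closed[OF emb[OF that]] j] .
    have f_emb: "f (M.embed ?k a) = N.embed j (\<phi> j a)" if a: "a \<in> carrier (M ?k)" for a
      unfolding \<phi>_def
    proof (rule N.le_embed_top_imp_eq[OF j])
      show "f (M.embed ?k a) \<sqsubseteq>\<^bsub>N.P\<^esub> N.unit_at j"
        using a k e emb[OF a] by (simp flip: \<rho>(2)[OF j] add: f_le_f M.embed_le_iff M.embed_apply)
    qed (use emb[OF a] f_closed in simp)
    have le: "\<phi> j a \<sqsubseteq>\<^bsub>N j\<^esub> \<phi> j b \<longleftrightarrow> a \<sqsubseteq>\<^bsub>M ?k\<^esub> b"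
      if ab: "a \<in> carrier (M ?k)" "b \<in> carrier (M ?k)" for a b
    proof -
      have "a \<sqsubseteq>\<^bsub>M ?k\<^esub> b \<longleftrightarrow> f (M.embed ?k a) \<sqsubseteq>\<^bsub>N.P\<^esub> f (M.embed ?k b)"
        using ab k emb by (simp add: f_le_f M.embed_le_iff M.embed_apply)
      also have "\<dots> \<longleftrightarrow> \<phi> j a \<sqsubseteq>\<^bsub>N j\<^esub> \<phi> j b"
        using ab j mem by (simp add: f_emb N.embed_le_iff N.embed_closed N.embed_apply)
      finally show ?thesis by simp
    qed
    show ?thesis
    proof (rule lattice_isoI[OF _ _ _ le])
      show "bij_betw (\<phi> j) (carrier (M ?k)) (carrier (N j))"
      proof (rule bij_betw_imageI)
        show "inj_on (\<phi> j) (carrier (M ?k))"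
        proof (rule inj_onI)
          fix a b assume ab: "a \<in> carrier (M ?k)" "b \<in> carrier (M ?k)" "\<phi> j a = \<phi> j b"
          then show "a = b"
            using le[OF ab(1,2)] le[OF ab(2,1)] mem[OF ab(1)] by (intro Mk.le_antisym) simp_all
        qed
        show "\<phi> j ` carrier (M ?k) = carrier (N j)"
        proof (intro equalityI subsetI)
          fix b assume b: "b \<in> carrier (N j)"
          let ?y = "N.embed j b"
          have y: "?y \<in> carrier N.P" using b j by (rule N.embed_closed[rotated])
          then have gy: "g ?y \<in> carrier M.P" by (rule g_closed)
          have "f (g ?y) \<sqsubseteq>\<^bsub>N.P\<^esub> f (M.unit_at ?k)"
            using y b j N.unit_at_closed[OF j]
            by (simp add: f_g \<rho>(2) N.embed_le_iff N.embed_apply)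
          then have "g ?y \<sqsubseteq>\<^bsub>M.P\<^esub> M.unit_at ?k" using gy e f_le_f by simp
          then have "g ?y = M.embed ?k (g ?y ?k)" using gy k by (intro M.le_embed_top_imp_eq)
          then have "\<phi> j (g ?y ?k) = b"
            using f_g[OF y] j by (simp add: \<phi>_def N.embed_apply)
          then show "b \<in> \<phi> j ` carrier (M ?k)"
            using M.carrierD[OF gy k] by (rule image_eqI[OF sym])
        qed (use mem in auto)
      qed
    qed (use Mk.lattice_axioms Nj.lattice_axioms in auto)
  qed
  ultimately show thesis using that by blast
qed

end

section \<open>Residuated mappings and matrices\<close>

locale bounded_gorder = bounded_lattice L for L :: "'a gorder" (structure)
begin

lemma finite_sup_insert:
  assumes "finite S" "S \<subseteq> carrier L" "a \<in> carrier L"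
  shows "\<Squnion> (insert a S) = a \<squnion> \<Squnion> S"
  using assms
  by (intro eq_if_same_upper_bounds) (simp_all add: finite_sup_in_carrier finite_sup_le_iff join_le_iff)

lemma ResD:
  assumes "f \<in> carrier (Res L)"
  shows "f \<in> extensional (carrier L)" "f \<bottom> = \<bottom>" "join_pres L L f"
    and "x \<in> carrier L \<Longrightarrow> f x \<in> carrier L"
    and "x \<in> carrier L \<Longrightarrow> y \<in> carrier L \<Longrightarrow> f (x \<squnion> y) = f x \<squnion> f y"
  using assms by (auto simp: Res_def join_pres_def PiE_iff)

lemma ResI:
  assumes "f \<in> extensional (carrier L)" "f \<bottom> = \<bottom>"
    and "\<And>x. x \<in> carrier L \<Longrightarrow> f x \<in> carrier L"
    and "\<And>x y. x \<in> carrier L \<Longrightarrow> y \<in> carrier L \<Longrightarrow> f (x \<squnion> y) = f x \<squnion> f y"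
  shows "f \<in> carrier (Res L)"
  using assms lattice_axioms by (auto simp: Res_def join_pres_def PiE_iff)

lemma Res_eqI:
  assumes "f \<in> carrier (Res L)" "g \<in> carrier (Res L)" "\<And>x. x \<in> carrier L \<Longrightarrow> f x = g x"
  shows "f = g"
  using assms ResD(1) by (intro extensionalityI)

lemma Res_finite_sup_le_iff:
  assumes f: "f \<in> carrier (Res L)" and S: "finite S" "S \<subseteq> carrier L" and z: "z \<in> carrier L"
  shows "f (\<Squnion> S) \<sqsubseteq> z \<longleftrightarrow> (\<forall>s\<in>S. f s \<sqsubseteq> z)"
  using S
proof induction
  case empty
  have "\<Squnion> {} = \<bottom>" by (simp add: Lattice.sup_def bottom_def)
  then show ?case using z by (simp add: ResD[OF f])
next
  case (insert a S)
  then have "a \<in> carrier L" "\<Squnion> S \<in> carrier L" by (auto simp: finite_sup_in_carrier)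
  with insert z show ?case
    by (simp add: finite_sup_insert ResD[OF f] join_le_iff)
qed

lemma Res_mult [simp]: "f \<otimes>\<^bsub>Res L\<^esub> g = compose (carrier L) f g"
  and Res_one [simp]: "\<one>\<^bsub>Res L\<^esub> = (\<lambda>x\<in>carrier L. x)"
  and Res_zero [simp]: "\<zero>\<^bsub>Res L\<^esub> = (\<lambda>x\<in>carrier L. \<bottom>)"
  and Res_add [simp]: "f \<oplus>\<^bsub>Res L\<^esub> g = (\<lambda>x\<in>carrier L. f x \<squnion> g x)"
  by (simp_all add: Res_def)

lemma Res_one_closed: "\<one>\<^bsub>Res L\<^esub> \<in> carrier (Res L)"
  by (rule ResI) auto

lemma Res_zero_closed: "\<zero>\<^bsub>Res L\<^esub> \<in> carrier (Res L)"
  by (rule ResI) auto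

lemma Res_mult_closed:
  assumes "f \<in> carrier (Res L)" "g \<in> carrier (Res L)"
  shows "f \<otimes>\<^bsub>Res L\<^esub> g \<in> carrier (Res L)"
  using ResD[OF assms(1)] ResD[OF assms(2)] by (intro ResI) (auto simp: compose_def)

lemma join_assoc:
  assumes "x \<in> carrier L" "y \<in> carrier L" "z \<in> carrier L"
  shows "(x \<squnion> y) \<squnion> z = x \<squnion> (y \<squnion> z)"
  using weak_join_assoc[OF assms] by (simp add: eq_is_equal)

lemma Res_add_closed:
  assumes "f \<in> carrier (Res L)" "g \<in> carrier (Res L)"
  shows "f \<oplus>\<^bsub>Res L\<^esub> g \<in> carrier (Res L)"
proof (rule ResI)
  note f = ResD[OF assms(1)] and g = ResD[OF assms(2)]
  fix x y assume xy: "x \<in> carrier L" "y \<in> carrier L"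
  show "(f \<oplus>\<^bsub>Res L\<^esub> g) (x \<squnion> y) = (f \<oplus>\<^bsub>Res L\<^esub> g) x \<squnion> (f \<oplus>\<^bsub>Res L\<^esub> g) y"
    using xy f g by (intro eq_if_same_upper_bounds) (auto simp: join_le_iff)
qed (use ResD[OF assms(1)] ResD[OF assms(2)] in auto)

lemma abelian_monoid_Res: "abelian_monoid (Res L)"
proof (rule abelian_monoidI)
  fix f g h assume "f \<in> carrier (Res L)" "g \<in> carrier (Res L)" "h \<in> carrier (Res L)"
  then show "(f \<oplus>\<^bsub>Res L\<^esub> g) \<oplus>\<^bsub>Res L\<^esub> h = f \<oplus>\<^bsub>Res L\<^esub> (g \<oplus>\<^bsub>Res L\<^esub> h)"
    by (intro Res_eqI Res_add_closed) (simp_all add: ResD join_assoc)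
next
  fix f assume "f \<in> carrier (Res L)"
  then show "\<zero>\<^bsub>Res L\<^esub> \<oplus>\<^bsub>Res L\<^esub> f = f"
    by (intro Res_eqI Res_add_closed Res_zero_closed) (simp_all add: ResD)
next
  fix f g
  show "f \<oplus>\<^bsub>Res L\<^esub> g = g \<oplus>\<^bsub>Res L\<^esub> f" by (simp add: join_comm[of L "f _"])
qed (simp_all only: Res_add_closed Res_zero_closed)

lemma finsum_Res_le_iff:
  assumes "finite S" "\<And>k. k \<in> S \<Longrightarrow> h k \<in> carrier (Res L)" "x \<in> carrier L" "z \<in> carrier L"
  shows "(\<Oplus>\<^bsub>Res L\<^esub>k\<in>S. h k) x \<sqsubseteq> z \<longleftrightarrow> (\<forall>k\<in>S. h k x \<sqsubseteq> z)"
  using assms(1,2)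
proof induction
  interpret R: abelian_monoid "Res L" by (rule abelian_monoid_Res)
  case empty
  show ?case using assms by simp
next
  interpret R: abelian_monoid "Res L" by (rule abelian_monoid_Res)
  case (insert a S)
  then have "h a \<in> carrier (Res L)" "(\<Oplus>\<^bsub>Res L\<^esub>k\<in>S. h k) \<in> carrier (Res L)"
    by (auto intro: R.finsum_closed)
  with insert assms(3,4) show ?case
    by (subst R.finsum_insert) (auto simp: join_le_iff ResD)
qed

lemma finsum_Res_closed:
  assumes "\<And>k. k \<in> S \<Longrightarrow> h k \<in> carrier (Res L)"
  shows "(\<Oplus>\<^bsub>Res L\<^esub>k\<in>S. h k) \<in> carrier (Res L)"
  using assms by (intro abelian_monoid.finsum_closed[OF abelian_monoid_Res]) auto

lemma Units_Res_iff:
  "f \<in> Units (Res L) \<longleftrightarrow> f \<in> carrier (Res L) \<and> f \<in> lattice_iso L L"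
proof
  assume "f \<in> Units (Res L)"
  then obtain g where f: "f \<in> carrier (Res L)" and g: "g \<in> carrier (Res L)"
    and eqs: "compose (carrier L) g f = (\<lambda>x\<in>carrier L. x)" "compose (carrier L) f g = (\<lambda>x\<in>carrier L. x)"
    by (auto simp: Units_def)
  have "g (f x) = x" "f (g x) = x" if "x \<in> carrier L" for x
    using that eqs by (metis compose_eq restrict_apply')+
  then have "bij_betw f (carrier L) (carrier L)"
    using ResD(4)[OF f] ResD(4)[OF g] by (intro bij_betw_byWitness[where f' = g]) auto
  then show "f \<in> carrier (Res L) \<and> f \<in> lattice_iso L L"
    using f ResD(3)[OF f] bij_join_pres_lattice_iso by blast
next
  assume "f \<in> carrier (Res L) \<and> f \<in> lattice_iso L L"
  then have f: "f \<in> carrier (Res L)" and iso: "f \<in> lattice_iso L L" by auto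
  define g where "g = (\<lambda>x\<in>carrier L. inv_into (carrier L) f x)"
  note inv = lattice_iso_inv_into[OF iso]
  note bij = lattice_isoD(1)[OF iso]
  have "g \<in> carrier (Res L)"
    using lattice_isoD(4,5)[OF inv] lattice_iso_bottom[OF inv bounded_lattice_axioms bounded_lattice_axioms]
    by (intro ResI) (auto simp: g_def)
  moreover have "compose (carrier L) g f = (\<lambda>x\<in>carrier L. x)"
    using bij ResD(4)[OF f] by (auto simp: g_def compose_def bij_betw_def restrict_def)
  moreover have "compose (carrier L) f g = (\<lambda>x\<in>carrier L. x)"
    using bij by (auto simp: g_def compose_def bij_betw_def restrict_def f_inv_into_f)
  ultimately show "f \<in> Units (Res L)"
    using f by (auto simp: Units_def)
qed

end

lemma Mat_simps:
  "carrier (Mat I R) = I \<rightarrow>\<^sub>E I \<rightarrow>\<^sub>E carrier R"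
  "F \<otimes>\<^bsub>Mat I R\<^esub> G = (\<lambda>i\<in>I. \<lambda>j\<in>I. \<Oplus>\<^bsub>R\<^esub>k\<in>I. F i k \<otimes>\<^bsub>R\<^esub> G k j)"
  "\<one>\<^bsub>Mat I R\<^esub> = (\<lambda>i\<in>I. \<lambda>j\<in>I. if i = j then \<one>\<^bsub>R\<^esub> else \<zero>\<^bsub>R\<^esub>)"
  by (simp_all add: Mat_def)

locale residuated_matrices = bounded_gorder L for L :: "'a gorder" (structure) +
  fixes I :: "'i set"
  assumes finite_index: "finite I"
begin

sublocale Q: bounded_family I "\<lambda>_. L"
  by unfold_locales

sublocale QR: bounded_gorder Q.P
  by unfold_locales

abbreviation "MR \<equiv> Mat I (Res L)"

definition mat_map :: "('i \<Rightarrow> 'i \<Rightarrow> 'a \<Rightarrow> 'a) \<Rightarrow> ('i \<Rightarrow> 'a) \<Rightarrow> 'i \<Rightarrow> 'a" where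
  "mat_map A = (\<lambda>x\<in>carrier Q.P. \<lambda>i\<in>I. matrix_row I L A i x)"

lemma MatD: "A \<in> carrier MR \<Longrightarrow> i \<in> I \<Longrightarrow> j \<in> I \<Longrightarrow> A i j \<in> carrier (Res L)"
  by (simp add: Mat_simps PiE_iff)

lemma Mat_entry_closed:
  assumes "A \<in> carrier MR" "i \<in> I" "j \<in> I" "x \<in> carrier Q.P"
  shows "A i j (x j) \<in> carrier L"
  using ResD(4)[OF MatD[OF assms(1-3)]] Q.carrierD[OF assms(4,3)] .

lemma Mat_eqI:
  assumes AB: "A \<in> carrier MR" "B \<in> carrier MR"
    and eq: "\<And>i j. i \<in> I \<Longrightarrow> j \<in> I \<Longrightarrow> A i j = B i j"
  shows "A = B"
proof (rule extensionalityI)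
  show "A \<in> extensional I" "B \<in> extensional I" using AB by (simp_all add: Mat_simps PiE_iff)
  fix i assume "i \<in> I"
  then show "A i = B i"
    using AB eq by (intro extensionalityI[of _ I]) (simp_all add: Mat_simps PiE_iff)
qed

lemma mat_map_apply: "x \<in> carrier Q.P \<Longrightarrow> i \<in> I \<Longrightarrow> mat_map A x i = matrix_row I L A i x"
  by (simp add: mat_map_def)

lemma matrix_row_closed:
  assumes "A \<in> carrier MR" "i \<in> I" "x \<in> carrier Q.P"
  shows "matrix_row I L A i x \<in> carrier L"
  using assms finite_index Mat_entry_closed unfolding matrix_row_def
  by (intro finite_sup_in_carrier) auto

lemma matrix_row_le_iff:
  assumes "A \<in> carrier MR" "i \<in> I" "x \<in> carrier Q.P" "z \<in> carrier L"
  shows "matrix_row I L A i x \<sqsubseteq> z \<longleftrightarrow> (\<forall>j\<in>I. A i j (x j) \<sqsubseteq> z)"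
  using assms finite_index Mat_entry_closed unfolding matrix_row_def
  by (subst finite_sup_le_iff) auto

lemma mat_map_in_carrier:
  assumes "A \<in> carrier MR" "x \<in> carrier Q.P"
  shows "mat_map A x \<in> carrier Q.P"
  using assms matrix_row_closed by (auto simp: mat_map_def product_lattice_simps)

lemma mat_map_closed:
  assumes A: "A \<in> carrier MR"
  shows "mat_map A \<in> carrier (Res Q.P)"
proof (rule QR.ResI)
  show "mat_map A \<in> extensional (carrier Q.P)" by (simp add: mat_map_def)
  show "mat_map A \<bottom>\<^bsub>Q.P\<^esub> = \<bottom>\<^bsub>Q.P\<^esub>"
  proof (rule Q.carrier_eqI)
    fix i assume i: "i \<in> I"
    have "matrix_row I L A i \<bottom>\<^bsub>Q.P\<^esub> \<sqsubseteq> \<bottom>"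
      using A i by (simp add: matrix_row_le_iff Q.bottom_product MatD[THEN ResD(2)])
    then show "mat_map A \<bottom>\<^bsub>Q.P\<^esub> i = \<bottom>\<^bsub>Q.P\<^esub> i"
      using A i matrix_row_closed by (simp add: mat_map_apply Q.bottom_product le_bottom_iff)
  qed (use A mat_map_in_carrier in auto)
  fix x y assume xy: "x \<in> carrier Q.P" "y \<in> carrier Q.P"
  show "mat_map A (x \<squnion>\<^bsub>Q.P\<^esub> y) = mat_map A x \<squnion>\<^bsub>Q.P\<^esub> mat_map A y"
  proof (rule Q.carrier_eqI)
    fix i assume i: "i \<in> I"
    have "matrix_row I L A i (x \<squnion>\<^bsub>Q.P\<^esub> y) = matrix_row I L A i x \<squnion> matrix_row I L A i y"
    proof (rule eq_if_same_upper_bounds)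
      fix z assume z: "z \<in> carrier L"
      have "A i j ((x \<squnion>\<^bsub>Q.P\<^esub> y) j) \<sqsubseteq> z \<longleftrightarrow> A i j (x j) \<sqsubseteq> z \<and> A i j (y j) \<sqsubseteq> z" if j: "j \<in> I" for j
        using xy j z ResD(4,5)[OF MatD[OF A i j]] Q.carrierD[OF xy(1) j] Q.carrierD[OF xy(2) j]
        by (simp add: Q.join_product join_le_iff)
      then show "matrix_row I L A i (x \<squnion>\<^bsub>Q.P\<^esub> y) \<sqsubseteq> z \<longleftrightarrow>
          matrix_row I L A i x \<squnion> matrix_row I L A i y \<sqsubseteq> z"
        using A i xy z by (auto simp: matrix_row_le_iff matrix_row_closed join_le_iff)
    qed (use A i xy matrix_row_closed in auto)
    then show "mat_map A (x \<squnion>\<^bsub>Q.P\<^esub> y) i = (mat_map A x \<squnion>\<^bsub>Q.P\<^esub> mat_map A y) i"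
      using A i xy by (simp add: Q.join_product mat_map_in_carrier mat_map_apply)
  qed (use A xy mat_map_in_carrier in auto)
qed (rule mat_map_in_carrier[OF A])

lemma Mat_mult_closed:
  assumes "A \<in> carrier MR" "B \<in> carrier MR"
  shows "A \<otimes>\<^bsub>MR\<^esub> B \<in> carrier MR"
proof -
  have "(\<Oplus>\<^bsub>Res L\<^esub>k\<in>I. A i k \<otimes>\<^bsub>Res L\<^esub> B k j) \<in> carrier (Res L)" if "i \<in> I" "j \<in> I" for i j
    using assms that by (intro finsum_Res_closed Res_mult_closed MatD)
  then show ?thesis by (auto simp: Mat_simps)
qed

lemma Mat_one_closed: "\<one>\<^bsub>MR\<^esub> \<in> carrier MR"
  using Res_one_closed Res_zero_closed by (auto simp: Mat_simps)

lemma mat_map_mult: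
  assumes A: "A \<in> carrier MR" and B: "B \<in> carrier MR"
  shows "mat_map (A \<otimes>\<^bsub>MR\<^esub> B) = mat_map A \<otimes>\<^bsub>Res Q.P\<^esub> mat_map B"
proof (rule QR.Res_eqI)
  show "mat_map (A \<otimes>\<^bsub>MR\<^esub> B) \<in> carrier (Res Q.P)"
    "mat_map A \<otimes>\<^bsub>Res Q.P\<^esub> mat_map B \<in> carrier (Res Q.P)"
    using assms by (intro mat_map_closed QR.Res_mult_closed Mat_mult_closed; simp)+
  fix x assume x: "x \<in> carrier Q.P"
  note Bx = mat_map_in_carrier[OF B x]
  have "mat_map (A \<otimes>\<^bsub>MR\<^esub> B) x = mat_map A (mat_map B x)"
  proof (rule Q.carrier_eqI)
    fix i assume i: "i \<in> I"
    have "matrix_row I L (A \<otimes>\<^bsub>MR\<^esub> B) i x = matrix_row I L A i (mat_map B x)"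
    proof (rule eq_if_same_upper_bounds)
      fix z assume z: "z \<in> carrier L"
      have "(A \<otimes>\<^bsub>MR\<^esub> B) i j (x j) \<sqsubseteq> z \<longleftrightarrow> (\<forall>k\<in>I. A i k (B k j (x j)) \<sqsubseteq> z)" if j: "j \<in> I" for j
      proof -
        have "(A \<otimes>\<^bsub>MR\<^esub> B) i j (x j) = (\<Oplus>\<^bsub>Res L\<^esub>k\<in>I. A i k \<otimes>\<^bsub>Res L\<^esub> B k j) (x j)"
          using i j by (simp add: Mat_simps)
        also have "\<dots> \<sqsubseteq> z \<longleftrightarrow> (\<forall>k\<in>I. (A i k \<otimes>\<^bsub>Res L\<^esub> B k j) (x j) \<sqsubseteq> z)"
          using i j z Q.carrierD[OF x j] finite_index A B
          by (intro finsum_Res_le_iff Res_mult_closed MatD)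
        finally show ?thesis using Q.carrierD[OF x j] by (simp add: compose_eq)
      qed
      moreover have "A i k (mat_map B x k) \<sqsubseteq> z \<longleftrightarrow> (\<forall>j\<in>I. A i k (B k j (x j)) \<sqsubseteq> z)" if k: "k \<in> I" for k
        unfolding mat_map_apply[OF x k] matrix_row_def
        using Mat_entry_closed[OF B k _ x] finite_index z
        by (subst Res_finite_sup_le_iff[OF MatD[OF A i k]]) auto
      ultimately show "matrix_row I L (A \<otimes>\<^bsub>MR\<^esub> B) i x \<sqsubseteq> z \<longleftrightarrow> matrix_row I L A i (mat_map B x) \<sqsubseteq> z"
        using i x z Bx A Mat_mult_closed[OF A B] by (auto simp: matrix_row_le_iff)
    qed (use i x Bx A Mat_mult_closed[OF A B] matrix_row_closed in auto)
    then show "mat_map (A \<otimes>\<^bsub>MR\<^esub> B) x i = mat_map A (mat_map B x) i"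
      using i x Bx by (simp add: mat_map_apply)
  qed (use x Bx A Mat_mult_closed[OF A B] mat_map_in_carrier in auto)
  then show "mat_map (A \<otimes>\<^bsub>MR\<^esub> B) x = (mat_map A \<otimes>\<^bsub>Res Q.P\<^esub> mat_map B) x"
    using x by (simp add: compose_eq)
qed

lemma mat_map_one: "mat_map \<one>\<^bsub>MR\<^esub> = \<one>\<^bsub>Res Q.P\<^esub>"
proof (rule QR.Res_eqI)
  show "mat_map \<one>\<^bsub>MR\<^esub> \<in> carrier (Res Q.P)" "\<one>\<^bsub>Res Q.P\<^esub> \<in> carrier (Res Q.P)"
    using mat_map_closed Mat_one_closed QR.Res_one_closed by blast+
  fix x assume x: "x \<in> carrier Q.P"
  have "mat_map \<one>\<^bsub>MR\<^esub> x = x"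
  proof (rule Q.carrier_eqI)
    fix i assume i: "i \<in> I"
    have "matrix_row I L \<one>\<^bsub>MR\<^esub> i x = x i"
    proof (rule eq_if_same_upper_bounds)
      fix z assume z: "z \<in> carrier L"
      have "\<one>\<^bsub>MR\<^esub> i j (x j) = (if i = j then x j else \<bottom>)" if "j \<in> I" for j
        using i that Q.carrierD[OF x that] by (simp add: Mat_simps)
      then show "matrix_row I L \<one>\<^bsub>MR\<^esub> i x \<sqsubseteq> z \<longleftrightarrow> x i \<sqsubseteq> z"
        using i x z Mat_one_closed by (auto simp: matrix_row_le_iff)
    qed (use i x Mat_one_closed matrix_row_closed Q.carrierD in auto)
    then show "mat_map \<one>\<^bsub>MR\<^esub> x i = x i" using i x by (simp add: mat_map_apply)
  qed (use x Mat_one_closed mat_map_in_carrier in auto)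
  then show "mat_map \<one>\<^bsub>MR\<^esub> x = \<one>\<^bsub>Res Q.P\<^esub> x" using x by simp
qed

lemma mat_map_embed:
  assumes A: "A \<in> carrier MR" and ij: "i \<in> I" "j \<in> I" and y: "y \<in> carrier L"
  shows "mat_map A (Q.embed j y) i = A i j y"
proof -
  have e: "Q.embed j y \<in> carrier Q.P" using ij y by (simp add: Q.embed_closed)
  have "matrix_row I L A i (Q.embed j y) = A i j y"
  proof (rule eq_if_same_upper_bounds)
    fix z assume z: "z \<in> carrier L"
    have "A i k (Q.embed j y k) = (if k = j then A i j y else \<bottom>)" if "k \<in> I" for k
      using that A ij by (simp add: Q.embed_apply MatD[THEN ResD(2)])
    then show "matrix_row I L A i (Q.embed j y) \<sqsubseteq> z \<longleftrightarrow> A i j y \<sqsubseteq> z"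
      using A ij e z by (auto simp: matrix_row_le_iff)
  qed (use A ij y e matrix_row_closed MatD[THEN ResD(4)] in auto)
  then show ?thesis using e ij by (simp add: mat_map_apply)
qed

lemma mat_map_inj: "inj_on mat_map (carrier MR)"
proof (rule inj_onI)
  fix A B assume AB: "A \<in> carrier MR" "B \<in> carrier MR" "mat_map A = mat_map B"
  show "A = B"
  proof (rule Mat_eqI)
    fix i j assume ij: "i \<in> I" "j \<in> I"
    show "A i j = B i j"
    proof (rule Res_eqI)
      show "A i j y = B i j y" if "y \<in> carrier L" for y
        using that AB ij mat_map_embed by metis
    qed (use AB ij MatD in auto)
  qed (use AB in auto)
qed

lemma mat_map_surj:
  assumes H: "H \<in> carrier (Res Q.P)"
  shows "\<exists>A\<in>carrier MR. mat_map A = H"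
proof
  define A where "A = (\<lambda>i\<in>I. \<lambda>j\<in>I. \<lambda>y\<in>carrier L. H (Q.embed j y) i)"
  have A_apply: "A i j y = H (Q.embed j y) i" if "i \<in> I" "j \<in> I" "y \<in> carrier L" for i j y
    using that by (simp add: A_def)
  have H_closed: "H (Q.embed j y) \<in> carrier Q.P" if "j \<in> I" "y \<in> carrier L" for j y
    using that QR.ResD(4)[OF H] Q.embed_closed by blast
  have "A i j \<in> carrier (Res L)" if ij: "i \<in> I" "j \<in> I" for i j
  proof (rule ResI)
    show "A i j \<in> extensional (carrier L)" using ij by (simp add: A_def)
    have "Q.embed j \<bottom> = \<bottom>\<^bsub>Q.P\<^esub>"
      using ij by (intro Q.carrier_eqI) (auto simp: Q.embed_closed Q.embed_apply Q.bottom_product)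
    then show "A i j \<bottom> = \<bottom>" using ij by (simp add: A_apply QR.ResD[OF H] Q.bottom_product)
    show "A i j y \<in> carrier L" if "y \<in> carrier L" for y
      using that ij H_closed Q.carrierD A_apply by metis
    fix x y assume xy: "x \<in> carrier L" "y \<in> carrier L"
    have e: "Q.embed j x \<in> carrier Q.P" "Q.embed j y \<in> carrier Q.P"
      using xy ij by (auto intro: Q.embed_closed)
    have "Q.embed j (x \<squnion> y) = Q.embed j x \<squnion>\<^bsub>Q.P\<^esub> Q.embed j y"
      using ij xy e
      by (intro Q.carrier_eqI) (auto simp: Q.embed_closed Q.embed_apply Q.join_product)
    then show "A i j (x \<squnion> y) = A i j x \<squnion> A i j y"
      using ij xy e by (simp add: A_apply QR.ResD[OF H] Q.join_product H_closed)
  qed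
  then show A: "A \<in> carrier MR" by (auto simp: Mat_simps A_def)
  show "mat_map A = H"
  proof (rule QR.Res_eqI[OF mat_map_closed[OF A] H])
    fix x assume x: "x \<in> carrier Q.P"
    let ?S = "(\<lambda>j. Q.embed j (x j)) ` I"
    have S: "finite ?S" "?S \<subseteq> carrier Q.P"
      using finite_index x Q.carrierD Q.embed_closed by auto
    have x_eq: "\<Squnion>\<^bsub>Q.P\<^esub> ?S = x"
    proof (rule Q.P.eq_if_same_upper_bounds)
      fix z assume z: "z \<in> carrier Q.P"
      show "\<Squnion>\<^bsub>Q.P\<^esub> ?S \<sqsubseteq>\<^bsub>Q.P\<^esub> z \<longleftrightarrow> x \<sqsubseteq>\<^bsub>Q.P\<^esub> z"
        using S z by (simp add: Q.P.finite_sup_le_iff Q.embed_le_iff) (simp add: product_lattice_simps)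
    qed (use x S Q.P.finite_sup_in_carrier in auto)
    show "mat_map A x = H x"
    proof (rule Q.carrier_eqI)
      fix i assume i: "i \<in> I"
      have "matrix_row I L A i x = H x i"
      proof (rule eq_if_same_upper_bounds)
        fix z assume z: "z \<in> carrier L"
        have "H x i \<sqsubseteq> z \<longleftrightarrow> H (\<Squnion>\<^bsub>Q.P\<^esub> ?S) \<sqsubseteq>\<^bsub>Q.P\<^esub> Q.coembed i z"
          using i z x QR.ResD(4)[OF H] by (simp add: x_eq Q.le_coembed_iff)
        also have "\<dots> \<longleftrightarrow> (\<forall>j\<in>I. H (Q.embed j (x j)) \<sqsubseteq>\<^bsub>Q.P\<^esub> Q.coembed i z)"
          using QR.Res_finite_sup_le_iff[OF H S] i z by (simp add: Q.coembed_closed)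
        also have "\<dots> \<longleftrightarrow> (\<forall>j\<in>I. A i j (x j) \<sqsubseteq> z)"
          using i z H_closed Q.carrierD[OF x] by (simp add: A_apply Q.le_coembed_iff)
        finally show "matrix_row I L A i x \<sqsubseteq> z \<longleftrightarrow> H x i \<sqsubseteq> z"
          using i x z A by (simp add: matrix_row_le_iff)
      qed (use i x A matrix_row_closed QR.ResD(4)[OF H] Q.carrierD in auto)
      then show "mat_map A x i = H x i" using i x by (simp add: mat_map_apply)
    qed (use x A mat_map_in_carrier QR.ResD(4)[OF H] in auto)
  qed
qed

lemma Units_Mat_iff:
  assumes A: "A \<in> carrier MR"
  shows "A \<in> Units MR \<longleftrightarrow> mat_map A \<in> lattice_iso Q.P Q.P"
proof -
  have inv_iff: "B \<otimes>\<^bsub>MR\<^esub> C = \<one>\<^bsub>MR\<^esub> \<longleftrightarrow>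
      mat_map B \<otimes>\<^bsub>Res Q.P\<^esub> mat_map C = \<one>\<^bsub>Res Q.P\<^esub>"
    if "B \<in> carrier MR" "C \<in> carrier MR" for B C
    using that inj_on_eq_iff[OF mat_map_inj Mat_mult_closed Mat_one_closed]
    by (simp only: mat_map_mult mat_map_one)
  have "A \<in> Units MR \<longleftrightarrow> mat_map A \<in> Units (Res Q.P)"
  proof
    assume "A \<in> Units MR"
    then obtain B where "B \<in> carrier MR" "B \<otimes>\<^bsub>MR\<^esub> A = \<one>\<^bsub>MR\<^esub>" "A \<otimes>\<^bsub>MR\<^esub> B = \<one>\<^bsub>MR\<^esub>"
      unfolding Units_def by blast
    then show "mat_map A \<in> Units (Res Q.P)"
      using A inv_iff mat_map_closed unfolding Units_def by blast
  next
    assume "mat_map A \<in> Units (Res Q.P)"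
    then obtain H where H: "H \<in> carrier (Res Q.P)"
      "H \<otimes>\<^bsub>Res Q.P\<^esub> mat_map A = \<one>\<^bsub>Res Q.P\<^esub>" "mat_map A \<otimes>\<^bsub>Res Q.P\<^esub> H = \<one>\<^bsub>Res Q.P\<^esub>"
      unfolding Units_def by blast
    then obtain B where "B \<in> carrier MR" "mat_map B = H" using mat_map_surj by blast
    then show "A \<in> Units MR"
      using A H inv_iff unfolding Units_def by blast
  qed
  then show ?thesis using A mat_map_closed QR.Units_Res_iff by blast
qed

end

theorem corollary4p2:
  fixes T :: "'t set" and I :: "'i set"
    and L :: "'t \<Rightarrow> 'a gorder"
    and A :: "'i \<Rightarrow> 'i \<Rightarrow> ('t \<Rightarrow> 'a) \<Rightarrow> ('t \<Rightarrow> 'a)"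
  assumes "finite T" and "finite I"
    and "\<And>t. t \<in> T \<Longrightarrow> lattice (L t)"
    and "\<And>t. t \<in> T \<Longrightarrow> finite (carrier (L t))"
    and "\<And>t. t \<in> T \<Longrightarrow> irreducible_lattice (L t)"
    and "A \<in> carrier (Mat I (Res (product_lattice T L)))"
  shows "A \<in> Units (Mat I (Res (product_lattice T L))) \<longleftrightarrow>
    (\<exists>(\<sigma> :: 't \<times> 'i \<Rightarrow> 't \<times> 'i) (\<phi> :: 't \<times> 'i \<Rightarrow> 'a \<Rightarrow> 'a).
       \<sigma> permutes (T \<times> I) \<and>
       (\<forall>p\<in>T \<times> I. \<phi> p \<in> lattice_iso (L (fst p)) (L (fst (inv_into (T \<times> I) \<sigma> p)))) \<and>
       (\<forall>t\<in>T. \<forall>i\<in>I. \<forall>x\<in>carrier (product_lattice I (\<lambda>_. product_lattice T L)).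
          (proj t \<circ> matrix_row I (product_lattice T L) A i) x =
          (\<phi> (\<sigma> (t, i)) \<circ> proj2 (\<sigma> (t, i))) x))"
proof -
  let ?K = "T \<times> I"
  let ?M = "\<lambda>p. L (fst p)"
  have bounded: "bounded_lattice (L t)" if "t \<in> T" for t
  proof (rule bounded_lattice_of_finite)
    show "carrier (L t) \<noteq> {}" using assms(5)[OF that] by (auto simp: irreducible_lattice_def)
  qed (use that assms(3,4) in auto)
  interpret F: bounded_family T L using bounded by (rule bounded_family.intro)
  interpret residuated_matrices "product_lattice T L" I
    using assms(2) F.P.bounded_lattice_axioms
    by (simp add: residuated_matrices_def residuated_matrices_axioms_def bounded_gorder_def)
  note A = assms(6)
  have entry: "x i t \<in> carrier (L t)" if "x \<in> carrier Q.P" "t \<in> T" "i \<in> I" for x t i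
    using F.carrierD[OF Q.carrierD] that by blast
  let ?u = "\<lambda>x. \<lambda>(t, i)\<in>?K. x i t"
  have u: "?u \<in> lattice_iso Q.P (product_lattice ?K ?M)"
    using assms(3) by (rule curry_lattice_iso)
  let ?c = "inv_into (carrier Q.P) ?u"
  show ?thesis
    unfolding Units_Mat_iff[OF A]
  proof
    assume "mat_map A \<in> lattice_iso Q.P Q.P"
    then have iso: "?u \<circ> (mat_map A \<circ> ?c) \<in> lattice_iso (product_lattice ?K ?M) (product_lattice ?K ?M)"
      using u by (blast intro: lattice_iso_comp lattice_iso_inv_into)
    interpret product_isomorphism ?K ?M ?K ?M "?u \<circ> (mat_map A \<circ> ?c)"
      using iso bounded assms(5)
      by (intro product_isomorphism.intro bounded_family.intro product_isomorphism_axioms.intro) auto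
    obtain \<rho> \<phi> where \<rho>: "bij_betw \<rho> ?K ?K"
      and \<phi>: "\<And>p. p \<in> ?K \<Longrightarrow> \<phi> p \<in> lattice_iso (?M (\<rho> p)) (?M p)"
      and eq: "\<And>z p. z \<in> carrier (product_lattice ?K ?M) \<Longrightarrow> p \<in> ?K
        \<Longrightarrow> (?u \<circ> (mat_map A \<circ> ?c)) z p = \<phi> p (z (\<rho> p))"
      using unique_factorisation by metis
    define \<sigma> where "\<sigma> p = (if p \<in> ?K then \<rho> p else p)" for p
    have \<sigma>_bij: "bij_betw \<sigma> ?K ?K"
      using \<rho> by (rule bij_betw_cong[THEN iffD1, rotated]) (simp add: \<sigma>_def)
    then have \<sigma>: "\<sigma> permutes ?K" by (rule bij_imp_permutes) (simp add: \<sigma>_def)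
    have inv_\<sigma>: "inv_into ?K \<sigma> p \<in> ?K" "\<rho> (inv_into ?K \<sigma> p) = p" if "p \<in> ?K" for p
    proof -
      have p: "p \<in> \<sigma> ` ?K" using that \<sigma>_bij by (simp add: bij_betw_def)
      then show "inv_into ?K \<sigma> p \<in> ?K" by (rule inv_into_into)
      then show "\<rho> (inv_into ?K \<sigma> p) = p" using f_inv_into_f[OF p] by (simp add: \<sigma>_def)
    qed
    have "matrix_row I F.P A i x t = \<phi> (t, i) (proj2 (\<sigma> (t, i)) x)"
      if t: "t \<in> T" and i: "i \<in> I" and x: "x \<in> carrier Q.P" for t i x
    proof -
      have "?c (?u x) = x"
        using lattice_isoD(1)[OF u] x by (intro inv_into_f_f) (auto simp: bij_betw_def)
      then have "matrix_row I F.P A i x t = (?u \<circ> (mat_map A \<circ> ?c)) (?u x) (t, i)"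
        using t i x by (simp add: mat_map_apply)
      also have "\<dots> = \<phi> (t, i) (?u x (\<rho> (t, i)))"
        using t i lattice_isoD(4)[OF u x] by (intro eq) auto
      also have "?u x (\<rho> (t, i)) = proj2 (\<sigma> (t, i)) x"
      proof -
        have "\<rho> (t, i) \<in> ?K" using \<rho> t i by (auto dest: bij_betwE)
        then show ?thesis using t i by (auto simp: \<sigma>_def proj2_def split: prod.split)
      qed
      finally show ?thesis .
    qed
    moreover have "inv_into ?K \<sigma> (\<sigma> (t, i)) = (t, i)" if "t \<in> T" "i \<in> I" for t i
      using that \<sigma>_bij by (intro inv_into_f_f) (auto simp: bij_betw_def)
    moreover have "\<phi> (inv_into ?K \<sigma> p) \<in> lattice_iso (?M p) (?M (inv_into ?K \<sigma> p))" if "p \<in> ?K" for p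
      using \<phi>[OF inv_\<sigma>(1)[OF that]] inv_\<sigma>(2)[OF that] by simp
    ultimately show "\<exists>\<sigma> \<phi>. \<sigma> permutes ?K \<and>
       (\<forall>p\<in>?K. \<phi> p \<in> lattice_iso (L (fst p)) (L (fst (inv_into ?K \<sigma> p)))) \<and>
       (\<forall>t\<in>T. \<forall>i\<in>I. \<forall>x\<in>carrier Q.P.
          (proj t \<circ> matrix_row I F.P A i) x = (\<phi> (\<sigma> (t, i)) \<circ> proj2 (\<sigma> (t, i))) x)"
      using \<sigma> by (intro exI[of _ \<sigma>] exI[of _ "\<lambda>p. \<phi> (inv_into ?K \<sigma> p)"]) (simp add: proj_def)
  next
    assume "\<exists>\<sigma> \<phi>. \<sigma> permutes ?K \<and>
       (\<forall>p\<in>?K. \<phi> p \<in> lattice_iso (L (fst p)) (L (fst (inv_into ?K \<sigma> p)))) \<and>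
       (\<forall>t\<in>T. \<forall>i\<in>I. \<forall>x\<in>carrier Q.P.
          (proj t \<circ> matrix_row I F.P A i) x = (\<phi> (\<sigma> (t, i)) \<circ> proj2 (\<sigma> (t, i))) x)"
    then obtain \<sigma> \<phi> where \<sigma>: "\<sigma> permutes ?K"
      and \<phi>: "\<forall>p\<in>?K. \<phi> p \<in> lattice_iso (L (fst p)) (L (fst (inv_into ?K \<sigma> p)))"
      and row: "\<forall>t\<in>T. \<forall>i\<in>I. \<forall>x\<in>carrier Q.P.
          (proj t \<circ> matrix_row I F.P A i) x = (\<phi> (\<sigma> (t, i)) \<circ> proj2 (\<sigma> (t, i))) x"
      by (elim exE conjE)
    have "inj_on (mat_map A) (carrier Q.P)"
    proof (rule inj_onI)
      fix x y assume x: "x \<in> carrier Q.P" and y: "y \<in> carrier Q.P" and xy: "mat_map A x = mat_map A y"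
      have eq: "x i t = y i t" if t: "t \<in> T" and i: "i \<in> I" for t i
      proof -
        have "(t, i) \<in> \<sigma> ` ?K" using permutes_image[OF \<sigma>] t i by simp
        then obtain s j where sj: "s \<in> T" "j \<in> I" "\<sigma> (s, j) = (t, i)" by auto
        have "matrix_row I F.P A j x s = matrix_row I F.P A j y s"
          using mat_map_apply[OF x sj(2), of A] mat_map_apply[OF y sj(2), of A] by (simp add: xy)
        then have "\<phi> (t, i) (x i t) = \<phi> (t, i) (y i t)"
          using row sj x y by (simp add: proj_def proj2_def)
        moreover have "inj_on (\<phi> (t, i)) (carrier (L t))"
          using lattice_isoD(1)[OF bspec[OF \<phi>, of "(t, i)"]] t i by (simp add: bij_betw_def)
        ultimately show ?thesis
          using entry[OF x t i] entry[OF y t i] by (meson inj_onD)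
      qed
      show "x = y"
      proof (rule Q.carrier_eqI[OF x y])
        fix i assume i: "i \<in> I"
        show "x i = y i"
          by (rule F.carrier_eqI[OF Q.carrierD[OF x i] Q.carrierD[OF y i]]) (rule eq[OF _ i])
      qed
    qed
    moreover have "finite (carrier Q.P)"
      using assms(1,2,4) by (auto simp: product_lattice_simps intro!: finite_PiE)
    moreover have "mat_map A ` carrier Q.P \<subseteq> carrier Q.P"
      using mat_map_in_carrier[OF A] by blast
    ultimately have "bij_betw (mat_map A) (carrier Q.P) (carrier Q.P)"
      by (simp add: bij_betw_def endo_inj_surj)
    then show "mat_map A \<in> lattice_iso Q.P Q.P"
      using QR.ResD(3)[OF mat_map_closed[OF A]] by (rule bij_join_pres_lattice_iso)
  qed
qed

end
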